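(* (ZFC) Let $\kappa$ be a cardinal with $\kappa^{<\kappa}=\kappa>\omega$. Then $\mathrm{ISO}(\kappa,\mathrm{DLO})$ is $S_\kappa$-complete.
   Context: $\mathrm{DLO}$ is the theory of dense linear orderings without end points. Structures with domain $\kappa$ in a countable relational vocabulary $\{R_n\}$ are coded by $\eta\in2^\kappa$ via a fixed bijection $\pi\colon\bigcup_n\{n\}\times\kappa^{\#R_n}\to\kappa$: $R_n(\bar\alpha)$ holds in $\mathcal A_\eta$ iff $\eta(\pi(n,\bar\alpha))=1$. For a class $M$ of such structures closed under isomorphism, $C(M)\subset2^\kappa$ is the set of codes of members of $M$ and $\mathrm{ISO}(M)$ is the isomorphism relation on $C(M)$; $\mathrm{ISO}(\kappa,T)=\mathrm{ISO}(\{\mathcal A\mid\operatorname{dom}\mathcal A=\kappa,\ \mathcal A\models T\})$. $S_\kappa$ is the class $\{\mathrm{ISO}(M)\mid C(M)\text{ is Borel}\}$. Topology on $\kappa^\kappa$ generated by $N_p=\{\eta\supset p\}$, $p\in\kappa^{<\kappa}$; Borel sets: smallest family containing closed sets and closed under $\kappa$-unions, $\kappa$-intersections and complements; Borel maps: preimages of open sets Borel. An equivalence relation $E$ is $S_\kappa$-complete if $E\in S_\kappa$ and every $F\in S_\kappa$ on some $Y\subset\kappa^\kappa$ admits a Borel $f$ with $\eta F\xi\iff f(\eta)Ef(\xi)$. *)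

theory Defs
  imports "HOL-Analysis.Abstract_Topology"
begin

unbundle cardinal_syntax

section \<open>The generalized Baire space\<close>

text \<open>The ordinal \<open>\<kappa>\<close> is the well-ordered type \<open>'k\<close>: its elements are the ordinals below \<open>\<kappa>\<close>, and
  an ordinal \<open>a < \<kappa>\<close> is identified with \<open>{..<a}\<close>. That \<open>\<kappa>\<close> is a cardinal is the assumption
  \<open>Card_order kappa\<close>.\<close>

definition kappa :: "'k::wellorder rel" where
  "kappa = {(x, y). x \<le> y}"

definition kzero :: "'k::wellorder" where
  "kzero = (LEAST x. True)"

definition kone :: "'k::wellorder" where
  "kone = (LEAST x. kzero < x)"

text \<open>\<open>\<kappa>\<^sup><\<^sup>\<kappa>\<close>, as partial functions whose domain is an ordinal below \<open>\<kappa>\<close>.\<close>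

definition kseqs :: "('k::wellorder \<rightharpoonup> 'k) set" where
  "kseqs = {p. \<exists>a. dom p = {..<a}}"

text \<open>The basic set \<open>N\<^sub>p = {\<eta> \<in> \<kappa>\<^sup>\<kappa>. p \<subseteq> \<eta>}\<close>.\<close>

definition cone_of :: "('k::wellorder \<rightharpoonup> 'k) \<Rightarrow> ('k \<Rightarrow> 'k) set" where
  "cone_of p = {\<eta>. p \<subseteq>\<^sub>m (\<lambda>x. Some (\<eta> x))}"

definition baire :: "('k::wellorder \<Rightarrow> 'k) topology" where
  "baire = topology_generated_by (cone_of ` kseqs)"

text \<open>The space \<open>2\<^sup>\<kappa>\<close>, as a subset of \<open>\<kappa>\<^sup>\<kappa>\<close>.\<close>

definition cantor :: "('k::wellorder \<Rightarrow> 'k) set" where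
  "cantor = {\<eta>. range \<eta> \<subseteq> {kzero, kone}}"

inductive_set kborel :: "('k::wellorder \<Rightarrow> 'k) set set" where
  closed: "closedin baire B \<Longrightarrow> B \<in> kborel"
| union: "(\<And>i::'k. B i \<in> kborel) \<Longrightarrow> (\<Union>i. B i) \<in> kborel"
| inter: "(\<And>i::'k. B i \<in> kborel) \<Longrightarrow> (\<Inter>i. B i) \<in> kborel"
| compl: "B \<in> kborel \<Longrightarrow> - B \<in> kborel"

text \<open>A function from the subspace \<open>Y\<close> to \<open>\<kappa>\<^sup>\<kappa>\<close> is Borel if preimages of open sets are Borel in \<open>Y\<close>;
  the Borel sets of \<open>Y\<close> are the traces on \<open>Y\<close> of the Borel sets of \<open>\<kappa>\<^sup>\<kappa>\<close>.\<close>

definition borel_map_on :: "('k::wellorder \<Rightarrow> 'k) set \<Rightarrow> (('k \<Rightarrow> 'k) \<Rightarrow> ('k \<Rightarrow> 'k)) \<Rightarrow> bool" where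
  "borel_map_on Y f \<longleftrightarrow>
     (\<forall>U. openin baire U \<longrightarrow> (\<exists>B\<in>kborel. {\<eta> \<in> Y. f \<eta> \<in> U} = B \<inter> Y))"

text \<open>Equivalence relations are sets of pairs; the set on which one lives is its \<open>Field\<close>.\<close>

definition borel_reducible ::
  "('k::wellorder \<Rightarrow> 'k) rel \<Rightarrow> ('k \<Rightarrow> 'k) rel \<Rightarrow> bool" where
  "borel_reducible F E \<longleftrightarrow>
     (\<exists>f. borel_map_on (Field F) f \<and> f ` Field F \<subseteq> Field E \<and>
          (\<forall>\<eta>\<in>Field F. \<forall>\<xi>\<in>Field F. (\<eta>, \<xi>) \<in> F \<longleftrightarrow> (f \<eta>, f \<xi>) \<in> E))"

section \<open>Coding of structures\<close>

text \<open>A countable relational vocabulary \<open>{R\<^sub>n}\<close>: \<open>V n\<close> is the arity of \<open>R\<^sub>n\<close>, or \<open>None\<close> if there is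
  no symbol with index \<open>n\<close>. A structure with domain \<open>\<kappa>\<close> is the set of those \<open>(n, \<alpha>)\<close> for which
  \<open>R\<^sub>n(\<alpha>)\<close> holds.\<close>

type_synonym vocabulary = "nat \<rightharpoonup> nat"
type_synonym 'k struct = "(nat \<times> 'k list) set"

definition atoms :: "vocabulary \<Rightarrow> (nat \<times> 'k list) set" where
  "atoms V = {(n, xs). V n = Some (length xs)}"

definition structures :: "vocabulary \<Rightarrow> 'k struct set" where
  "structures V = Pow (atoms V)"

definition isomorphic :: "vocabulary \<Rightarrow> 'k struct \<Rightarrow> 'k struct \<Rightarrow> bool" where
  "isomorphic V A B \<longleftrightarrow>
     (\<exists>h. bij h \<and> (\<forall>(n, xs)\<in>atoms V. (n, xs) \<in> A \<longleftrightarrow> (n, map h xs) \<in> B))"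

definition iso_closed :: "vocabulary \<Rightarrow> 'k struct set \<Rightarrow> bool" where
  "iso_closed V M \<longleftrightarrow>
     M \<subseteq> structures V \<and> (\<forall>A\<in>M. \<forall>B\<in>structures V. isomorphic V A B \<longrightarrow> B \<in> M)"

definition coding :: "vocabulary \<Rightarrow> (nat \<times> 'k list \<Rightarrow> 'k) \<Rightarrow> bool" where
  "coding V \<pi> \<longleftrightarrow> bij_betw \<pi> (atoms V) UNIV"

definition struct_of ::
  "vocabulary \<Rightarrow> (nat \<times> 'k list \<Rightarrow> 'k) \<Rightarrow> ('k::wellorder \<Rightarrow> 'k) \<Rightarrow> 'k struct" where
  "struct_of V \<pi> \<eta> = {(n, xs) \<in> atoms V. \<eta> (\<pi> (n, xs)) = kone}"

definition codes ::
  "vocabulary \<Rightarrow> (nat \<times> 'k list \<Rightarrow> 'k) \<Rightarrow> 'k struct set \<Rightarrow> ('k::wellorder \<Rightarrow> 'k) set" where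
  "codes V \<pi> M = {\<eta> \<in> cantor. struct_of V \<pi> \<eta> \<in> M}"

definition ISO ::
  "vocabulary \<Rightarrow> (nat \<times> 'k list \<Rightarrow> 'k) \<Rightarrow> 'k struct set \<Rightarrow> ('k::wellorder \<Rightarrow> 'k) rel" where
  "ISO V \<pi> M = {(\<eta>, \<xi>). \<eta> \<in> codes V \<pi> M \<and> \<xi> \<in> codes V \<pi> M \<and>
                   isomorphic V (struct_of V \<pi> \<eta>) (struct_of V \<pi> \<xi>)}"

lemma Field_ISO: "Field (ISO V \<pi> M) = codes V \<pi> M"
proof -
  have "isomorphic V A A" for A :: "'a struct"
    unfolding isomorphic_def by (rule exI[of _ id]) auto
  then show ?thesis
    by (auto simp: ISO_def Field_def)
qed

definition S_class :: "('k::wellorder \<Rightarrow> 'k) rel set" where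
  "S_class = {ISO V \<pi> M | V \<pi> M. coding V \<pi> \<and> iso_closed V M \<and> codes V \<pi> M \<in> kborel}"

definition S_complete :: "('k::wellorder \<Rightarrow> 'k) rel \<Rightarrow> bool" where
  "S_complete E \<longleftrightarrow> E \<in> S_class \<and> (\<forall>F\<in>S_class. borel_reducible F E)"

section \<open>First-order theories\<close>

text \<open>First-order formulas over relation symbols \<open>R\<^sub>n\<close>, with variables named by natural numbers.\<close>

datatype fm =
    Eq nat nat
  | Rel nat "nat list"
  | Neg fm
  | Conj fm fm
  | Disj fm fm
  | Imp fm fm
  | All nat fm
  | Ex nat fm

primrec sat :: "'k struct \<Rightarrow> (nat \<Rightarrow> 'k) \<Rightarrow> fm \<Rightarrow> bool" where
  "sat A v (Eq x y) \<longleftrightarrow> v x = v y"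
| "sat A v (Rel n xs) \<longleftrightarrow> (n, map v xs) \<in> A"
| "sat A v (Neg p) \<longleftrightarrow> \<not> sat A v p"
| "sat A v (Conj p q) \<longleftrightarrow> sat A v p \<and> sat A v q"
| "sat A v (Disj p q) \<longleftrightarrow> sat A v p \<or> sat A v q"
| "sat A v (Imp p q) \<longleftrightarrow> (sat A v p \<longrightarrow> sat A v q)"
| "sat A v (All x p) \<longleftrightarrow> (\<forall>a. sat A (v(x := a)) p)"
| "sat A v (Ex x p) \<longleftrightarrow> (\<exists>a. sat A (v(x := a)) p)"

definition models :: "'k struct \<Rightarrow> fm set \<Rightarrow> bool" where
  "models A T \<longleftrightarrow> (\<forall>p\<in>T. \<forall>v. sat A v p)"

definition ISO_theory ::
  "vocabulary \<Rightarrow> (nat \<times> 'k list \<Rightarrow> 'k) \<Rightarrow> fm set \<Rightarrow> ('k::wellorder \<Rightarrow> 'k) rel" where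
  "ISO_theory V \<pi> T = ISO V \<pi> {A \<in> structures V. models A T}"

text \<open>Strict dense linear orderings without end points, in the vocabulary with the single binary
  symbol \<open>R\<^sub>0\<close>.\<close>

definition order_vocabulary :: vocabulary where
  "order_vocabulary = [0 \<mapsto> 2]"

abbreviation Less :: "nat \<Rightarrow> nat \<Rightarrow> fm" where
  "Less x y \<equiv> Rel 0 [x, y]"

definition DLO :: "fm set" where
  "DLO =
    {All 0 (Neg (Less 0 0)),
     All 0 (All 1 (All 2 (Imp (Conj (Less 0 1) (Less 1 2)) (Less 0 2)))),
     All 0 (All 1 (Disj (Less 0 1) (Disj (Eq 0 1) (Less 1 0)))),
     All 0 (All 1 (Imp (Less 0 1) (Ex 2 (Conj (Less 0 2) (Less 2 1))))),
     All 0 (Ex 1 (Less 0 1)),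
     All 0 (Ex 1 (Less 1 0))}"

end

theory Submission
  imports Defs "HOL-Library.Countable_Set_Type" "HOL-Library.Option_ord" "HOL-Library.Product_Lexorder"
begin

text \<open>Let \<open>Q\<close> be a saturated linear order of size \<open>\<kappa>\<close> with a generic colouring by \<open>\<kappa>\<close>; by
  back-and-forth, every permutation of the colours lifts to an automorphism of \<open>Q\<close>. A structure \<open>A\<close>
  on \<open>\<kappa>\<close> is turned into the tree \<open>Q\<^sup><\<^sup>\<kappa>\<close>, in which a node \<open>s\<close> is labelled by the atomic type in \<open>A\<close> of
  the sequence of colours of \<open>s\<close>. An isomorphism of two such labelled trees yields an isomorphism of the
  structures: choose a branch of length \<open>\<kappa>\<close> through one tree which, together with its image, exhausts both
  structures. Finally the labelled tree is written as a linear order: take the lexicographic order,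
  follow each node by a well-ordered block of bits listing its label, and realise the bits by
  countable dense orders with different end points, separated by copies of \<open>Q\<close>, whose intervals are uncountable.
  Each value of the resulting map between codes depends on a single coordinate, so that the map is
  continuous.\<close>

section \<open>Cardinal arithmetic\<close>

text \<open>The obstacle is that a code of a structure comes with an enumeration of its domain,
  which the order must forget. All enumerations are therefore offered at once: nodes are arbitrary
  sequences, and an isomorphism of structures, being a permutation of the colours, acts on all of
  them through its lift. Finite sequences would give only a back-and-forth system, which for
  uncountable structures need not yield an isomorphism; a branch of length \<kappa> can name every
  element. The labels include equality between positions: it makes the map read off from two
  branches well defined, and through the formulas \<open>x = x\<close> it exposes the length of a
  node. Lengths are what allows the initial segment relation to be recovered after the tree has been
  flattened into a lexicographic order. The assumption on \<kappa> keeps the coloured order and the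
  tree at size \<kappa>, and it gives the regularity of \<kappa> behind saturation and continuity.
  Uncountability distinguishes the countable cells from the intervals that separate them.\<close>

locale kappa_exp =
  fixes K :: "'k::wellorder itself"
  assumes card_order_kappa: "Card_order (kappa :: 'k rel)"
    and natLeq_kappa: "natLeq <o (kappa :: 'k rel)"
    and kseqs_kappa: "|kseqs :: ('k \<rightharpoonup> 'k) set| =o (kappa :: 'k rel)"
begin

lemma Field_kappa: "Field (kappa :: 'k rel) = UNIV"
  by (auto simp: kappa_def Field_def)

lemma card_of_UNIV_kappa: "|UNIV :: 'k set| =o (kappa :: 'k rel)"
  using card_of_Field_ordIso[OF card_order_kappa] by (simp add: Field_kappa)

lemma uncountable_UNIV: "\<not> countable (UNIV :: 'k set)"
proof
  assume "countable (UNIV :: 'k set)"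
  then have "|UNIV :: 'k set| \<le>o natLeq"
    by (simp add: countable_card_le_natLeq)
  then have "(kappa :: 'k rel) \<le>o natLeq"
    using ordIso_ordLeq_trans[OF ordIso_symmetric[OF card_of_UNIV_kappa]] by blast
  then show False
    using natLeq_kappa not_ordLess_ordLeq by blast
qed

lemma infinite_UNIV_kappa: "infinite (UNIV :: 'k set)"
  using uncountable_UNIV countable_finite by blast

lemma card_of_lessThan: "|{..<a :: 'k}| <o |UNIV :: 'k set|"
proof -
  have "underS kappa a = {..<a}"
    by (auto simp: underS_def kappa_def)
  then have "|{..<a}| <o (kappa :: 'k rel)"
    using card_of_underS[OF card_order_kappa, of a] by (simp add: Field_kappa)
  then show ?thesis
    using card_of_UNIV_kappa ordIso_symmetric ordLess_ordIso_trans by blast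
qed

lemma image_lessThan_neq_UNIV: "f ` {..<a} \<noteq> (UNIV :: 'k set)" for a :: 'k
  using card_of_ordLess2[of "UNIV :: 'k set" "{..<a}"] card_of_lessThan[of a] by auto

text \<open>A greatest element could be absorbed: removing it from an infinite set does not change
  the cardinality, whereas proper initial segments are smaller than \<kappa>.\<close>

lemma ex_greater: "\<exists>b. (a :: 'k) < b"
proof (rule ccontr)
  assume "\<nexists>b. a < b"
  then have U: "UNIV = insert a {..<a}"
    by (auto simp: not_less order_le_less)
  then have "infinite {..<a}"
    using infinite_UNIV_kappa by (metis finite_insert)
  then obtain f where "f ` {..<a} = insert a {..<a}"
    using infinite_imp_bij_betw2[of "{..<a}" a] by (metis Un_insert_right bij_betw_imp_surj_on sup_bot.right_neutral)
  then show False
    using image_lessThan_neq_UNIV U by metis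
qed

lemma atMost_eq_lessThan: "\<exists>b. {..a} = {..<b :: 'k}"
proof
  show "{..a} = {..<LEAST b. a < b}"
    using LeastI_ex[OF ex_greater, of a] not_less_Least[of _ "\<lambda>b. a < b"]
    by (force simp: not_less)
qed

lemma image_atMost_neq_UNIV: "f ` {..a} \<noteq> (UNIV :: 'k set)" for a :: 'k
proof -
  obtain b where "{..a} = {..<b}"
    using atMost_eq_lessThan by blast
  then show ?thesis
    using image_lessThan_neq_UNIV by simp
qed

text \<open>Koenig's argument: a map cofinal on \<open>a\<close> would allow diagonalising against an enumeration of
  the functions on \<open>a\<close>.\<close>

lemma bounded_image:
  fixes g :: "'k \<Rightarrow> 'k"
  shows "\<exists>b. \<forall>x<a. g x < b"
proof (rule ccontr)
  assume unb: "\<nexists>b. \<forall>x<a. g x < b"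
  have "|kseqs :: ('k \<rightharpoonup> 'k) set| \<le>o |UNIV :: 'k set|"
    using kseqs_kappa card_of_UNIV_kappa ordIso_symmetric ordIso_transitive ordIso_iff_ordLeq by blast
  moreover have "(\<lambda>x. if x < a then Some x else None) \<in> (kseqs :: ('k \<rightharpoonup> 'k) set)"
    by (auto simp: kseqs_def dom_def intro!: exI[of _ a] split: if_splits)
  then have "(kseqs :: ('k \<rightharpoonup> 'k) set) \<noteq> {}" by blast
  ultimately obtain e :: "'k \<Rightarrow> ('k \<rightharpoonup> 'k)" where e: "range e = kseqs"
    using card_of_ordLeq2 by metis
  have "\<exists>v. v \<notin> (\<lambda>i. the (e i x)) ` {..g x}" for x
    using image_atMost_neq_UNIV[of "\<lambda>i. the (e i x)" "g x"] by blast
  then obtain v where v: "v x \<notin> (\<lambda>i. the (e i x)) ` {..g x}" for x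
    by metis
  define p where "p = (\<lambda>x. if x < a then Some (v x) else None)"
  have "p \<in> kseqs"
    by (auto simp: kseqs_def p_def dom_def intro!: exI[of _ a] split: if_splits)
  then obtain i where i: "p = e i"
    using e by (metis imageE)
  obtain x where "x < a" "i \<le> g x"
    using unb not_le by metis
  moreover have "the (e i x) = v x"
    using \<open>x < a\<close> i[symmetric] by (simp add: p_def)
  ultimately show False
    using v[of x] by (metis atMost_iff imageI)
qed

section \<open>Codings of pairs, sums and finite lists\<close>

lemma surj_pair: "\<exists>m :: 'k \<Rightarrow> 'k \<times> 'k. bij m"
  using card_of_Times_same_infinite[OF infinite_UNIV_kappa] card_of_ordIso ordIso_symmetric
  by (metis UNIV_Times_UNIV)

lemma surj_sum: "\<exists>m :: 'k \<Rightarrow> 'k + 'k. surj m"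
proof -
  obtain m :: "'k \<Rightarrow> 'k \<times> 'k" where m: "bij m"
    using surj_pair by blast
  obtain o1 :: 'k where o1: "kzero < o1"
    using ex_greater by blast
  define t where "t a = (if fst (m a) = kzero then Inl (snd (m a)) else Inr (snd (m a)))" for a
  have "\<exists>a. t a = x" for x
  proof (cases x)
    case (Inl j)
    obtain a where "m a = (kzero, j)" using m by (metis bij_pointE)
    then show ?thesis using Inl by (auto simp: t_def intro!: exI[of _ a])
  next
    case (Inr j)
    obtain a where "m a = (o1, j)" using m by (metis bij_pointE)
    then show ?thesis using Inr o1 by (auto simp: t_def intro!: exI[of _ a])
  qed
  then have "surj t" by (metis surjI)
  then show ?thesis by blast
qed

text \<open>Fibres of the first projection of \<kappa> \<times> \<kappa> have size \<kappa>, so none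
  is bounded. The function becomes the colouring rule in \<open>hausdorff_colour\<close>: every
  colour is available arbitrarily late.\<close>

lemma ex_unbounded_fibres: "\<exists>b :: 'k \<Rightarrow> 'k. \<forall>k a. \<exists>x\<ge>a. b x = k"
proof -
  obtain m :: "'k \<Rightarrow> 'k \<times> 'k" where m: "bij m"
    using surj_pair by blast
  have "\<exists>x\<ge>a. fst (m x) = k" for a k
  proof (rule ccontr)
    assume "\<not> ?thesis"
    then have less: "x < a" if "fst (m x) = k" for x
      using that not_le by blast
    have "y \<in> (snd \<circ> m) ` {..<a}" for y
    proof -
      obtain x where "m x = (k, y)"
        using m by (metis bij_pointE)
      then show ?thesis
        using less[of x] by (force intro: image_eqI[of _ _ x])
    qed
    then show False
      using image_lessThan_neq_UNIV by blast
  qed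
  then show ?thesis
    by (intro exI[of _ "fst \<circ> m"]) auto
qed

text \<open>The tags \<open>kzero\<close> and \<open>o1\<close> tell the empty list from a nonempty
  one. An inverse later lists all atomic formulas along a block of length \<kappa>.\<close>

lemma inj_nat_lists: "\<exists>e :: nat \<times> 'k list \<Rightarrow> 'k. inj e"
proof -
  obtain m :: "'k \<Rightarrow> 'k \<times> 'k" where m: "bij m"
    using surj_pair by blast
  define P where "P x y = inv m (x, y)" for x y
  have P: "P x y = P x' y' \<longleftrightarrow> x = x' \<and> y = y'" for x y x' y'
    unfolding P_def by (metis Pair_inject bij_inv_eq_iff m)
  obtain o1 :: 'k where o1: "kzero < o1"
    using ex_greater by blast
  define enc where "enc = rec_list (P kzero kzero) (\<lambda>x _ r. P o1 (P x r))"
  have enc: "enc [] = P kzero kzero" "enc (x # xs) = P o1 (P x (enc xs))" for x xs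
    by (simp_all add: enc_def)
  have enc_inj: "enc xs = enc ys \<Longrightarrow> xs = ys" for xs ys
  proof (induction xs arbitrary: ys)
    case Nil
    then show ?case using o1 by (cases ys) (auto simp: enc P)
  next
    case (Cons x xs)
    then show ?case using o1 by (cases ys) (auto simp: enc P)
  qed
  obtain n :: "nat \<Rightarrow> 'k" where n: "inj n"
    using infinite_UNIV_kappa infinite_countable_subset by blast
  have "inj (\<lambda>(i, xs). P (n i) (enc xs))"
    using n enc_inj by (auto simp: inj_on_def P)
  then show ?thesis by blast
qed

lemma surj_nat_lists: "\<exists>m :: 'k \<Rightarrow> nat \<times> 'k list. surj m"
proof -
  obtain e :: "nat \<times> 'k list \<Rightarrow> 'k" where "inj e" 
    using inj_nat_lists by blast
  then have "surj (inv e)" by (rule inj_imp_surj_inv)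
  then show ?thesis by blast
qed

end

section \<open>Lexicographic orders\<close>

text \<open>A separate type is used because the function type already carries the pointwise
  order.\<close>

typedef ('k, 'a) lexfun = "UNIV :: ('k \<Rightarrow> 'a) set"
  morphisms app Lex ..

lemma app_Lex [simp]: "app (Lex f) = f"
  by (simp add: Lex_inverse)

lemma lexfun_eqI: "(\<And>x. app f x = app g x) \<Longrightarrow> f = g"
  by (metis app_inject ext)

instantiation lexfun :: (wellorder, linorder) linorder
begin

definition less_lexfun :: "('a::wellorder, 'b::linorder) lexfun \<Rightarrow> ('a, 'b) lexfun \<Rightarrow> bool" where
  "f < g \<longleftrightarrow> (\<exists>a. (\<forall>b<a. app f b = app g b) \<and> app f a < app g a)"

definition less_eq_lexfun :: "('a::wellorder, 'b::linorder) lexfun \<Rightarrow> ('a, 'b) lexfun \<Rightarrow> bool" where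
  "(f :: ('a, 'b) lexfun) \<le> g \<longleftrightarrow> f = g \<or> f < g"

instance
proof
  have irrefl: "\<not> f < f" for f :: "('a, 'b) lexfun"
    by (simp add: less_lexfun_def)
  have trans: "f < h" if fg: "f < g" and gh: "g < h" for f g h :: "('a, 'b) lexfun"
  proof -
    obtain a where a: "\<forall>b<a. app f b = app g b" "app f a < app g a"
      using fg by (auto simp: less_lexfun_def)
    obtain c where c: "\<forall>b<c. app g b = app h b" "app g c < app h c"
      using gh by (auto simp: less_lexfun_def)
    consider "a < c" | "a = c" | "c < a" by (rule linorder_cases)
    then show ?thesis
    proof cases
      case 1
      then have "\<forall>b<a. app f b = app h b" "app f a < app h a" using a c by auto
      then show ?thesis by (auto simp: less_lexfun_def)
    next
      case 2
      then have "\<forall>b<a. app f b = app h b" "app f a < app h a" using a c by auto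
      then show ?thesis by (auto simp: less_lexfun_def)
    next
      case 3
      then have "\<forall>b<c. app f b = app h b" "app f c < app h c" using a c by auto
      then show ?thesis by (auto simp: less_lexfun_def)
    qed
  qed
  have total: "f < g \<or> f = g \<or> g < f" for f g :: "('a, 'b) lexfun"
  proof (cases "f = g")
    case False
    then have ex: "\<exists>x. app f x \<noteq> app g x" using lexfun_eqI[of f g] by blast
    define a where "a = (LEAST x. app f x \<noteq> app g x)"
    have "app f a \<noteq> app g a" unfolding a_def by (rule LeastI_ex[OF ex])
    moreover have "app f b = app g b" if "b < a" for b
      using that not_less_Least unfolding a_def by blast
    ultimately have "f < g \<or> g < f"
      unfolding less_lexfun_def by (metis linorder_neqE)
    then show ?thesis by blast
  qed simp
  fix f g h :: "('a, 'b) lexfun"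
  show "(f < g) = (f \<le> g \<and> \<not> g \<le> f)" using irrefl trans by (auto simp: less_eq_lexfun_def)
  show "f \<le> f" by (simp add: less_eq_lexfun_def)
  show "f \<le> g \<Longrightarrow> g \<le> h \<Longrightarrow> f \<le> h" using trans by (auto simp: less_eq_lexfun_def)
  show "f \<le> g \<Longrightarrow> g \<le> f \<Longrightarrow> f = g" using irrefl trans by (auto simp: less_eq_lexfun_def)
  show "f \<le> g \<or> g \<le> f" using total by (auto simp: less_eq_lexfun_def)
qed

end

lemma less_lexfunI:
  "(\<And>b. b < a \<Longrightarrow> app f b = app g b) \<Longrightarrow> app f a < app g a \<Longrightarrow> f < g"
  by (auto simp: less_lexfun_def)

section \<open>A saturated coloured order\<close>

text \<open>Hausdorff's \<open>\<eta>\<close>-set, with three signs instead of two digits so that every element can be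
  perturbed in both directions.\<close>

typedef (overloaded) ('k::wellorder) sat_order =
  "{f :: ('k, int) lexfun. range (app f) \<subseteq> {-1, 0, 1} \<and> (\<exists>a. \<forall>x\<ge>a. app f x = 0)}"
  by (rule exI[of _ "Lex (\<lambda>_. 0)"]) auto

instantiation sat_order :: (wellorder) linorder
begin

definition less_sat_order :: "('a::wellorder) sat_order \<Rightarrow> 'a sat_order \<Rightarrow> bool" where
  "f < g \<longleftrightarrow> Rep_sat_order f < Rep_sat_order g"

definition less_eq_sat_order :: "('a::wellorder) sat_order \<Rightarrow> 'a sat_order \<Rightarrow> bool" where
  "f \<le> g \<longleftrightarrow> Rep_sat_order f \<le> Rep_sat_order g"

instance
  by standard (auto simp: less_sat_order_def less_eq_sat_order_def less_le Rep_sat_order_inject)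

end

text \<open>Containment in the image of a proper initial segment expresses size below \<kappa>. The
  colour is part of the saturation condition, so that it can be prescribed in every small cut;
  \<open>num\<close> bounds the size of the order by \<kappa>.\<close>

locale saturated_order = kappa_exp K for K :: "'k::wellorder itself" +
  fixes col :: "'q::linorder \<Rightarrow> 'k"
    and num :: "'q \<Rightarrow> 'k"
  assumes saturated: "\<And>X Y G a k. X \<union> Y \<subseteq> G ` {..<a :: 'k} \<Longrightarrow> (\<And>x y. x \<in> X \<Longrightarrow> y \<in> Y \<Longrightarrow> x < y)
      \<Longrightarrow> \<exists>z. (\<forall>x\<in>X. x < z) \<and> (\<forall>y\<in>Y. z < y) \<and> col z = k"
    and inj_num: "inj num"

context kappa_exp
begin

text \<open>The colour is read at the last nonzero place. Saturation only produces elements that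
  have such a place; for the others the arbitrary value of \<open>THE\<close> is harmless.\<close>

definition hausdorff_colour :: "('k \<Rightarrow> 'k) \<Rightarrow> 'k sat_order \<Rightarrow> 'k" where
  "hausdorff_colour b f =
     b (THE c. app (Rep_sat_order f) c \<noteq> 0 \<and> (\<forall>x>c. app (Rep_sat_order f) x = 0))"

text \<open>The cut is filled by recursion on positions: among members of \<open>X\<close> agreeing
  with the part already built, the largest next value is followed; when none is left, the smallest
  next value among those of \<open>Y\<close>. With three possible values, \<open>Max\<close> and
  \<open>Min\<close> exist at every position, limits included. The inequalities are weak because
  \<open>p\<close> may itself lie in \<open>X\<close> or \<open>Y\<close>.\<close>

lemma ex_cut:
  fixes X Y :: "('k, int) lexfun set"
  assumes signs: "\<And>f x. f \<in> X \<union> Y \<Longrightarrow> app f x \<in> {-1, 0, 1}"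
    and less: "\<And>f g. f \<in> X \<Longrightarrow> g \<in> Y \<Longrightarrow> f < g"
    and bounded: "\<And>f x. f \<in> X \<union> Y \<Longrightarrow> x \<ge> b \<Longrightarrow> app f x = 0"
  shows "\<exists>p. (\<forall>x. app p x \<in> {-1, 0, 1}) \<and> (\<forall>x\<ge>b. app p x = 0) \<and> (\<forall>f\<in>X. f \<le> p) \<and> (\<forall>f\<in>Y. p \<le> f)"
proof -
  define V where "V S p a = (\<lambda>f. app f a) ` {f \<in> S. \<forall>c<a. app f c = p c}"
    for S :: "('k, int) lexfun set" and p a
  define step where "step p a = (if V X p a \<noteq> {} then Max (V X p a)
      else if V Y p a \<noteq> {} then Min (V Y p a) else 0)" for p a
  have fin: "finite (V S p a)" "V S p a \<subseteq> {-1, 0, 1}" if "S \<subseteq> X \<union> Y" for S p a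
  proof -
    show "V S p a \<subseteq> {-1, 0, 1}" using signs that unfolding V_def by blast
    then show "finite (V S p a)" by (rule finite_subset) simp
  qed
  have "\<exists>p. \<forall>a. p a = step p a"
  proof (rule dependent_wf_choice[OF wf])
    fix f g :: "'k \<Rightarrow> int" and x r
    assume *: "\<And>z. (z, x) \<in> {(y, x). y < x} \<Longrightarrow> f z = g z"
    have "V S f x = V S g x" for S
      using * by (simp add: V_def)
    then show "(r = step f x) = (r = step g x)"
      by (simp add: step_def)
  qed simp
  then obtain p where p: "\<And>a. p a = step p a" by blast
  have p_in: "p a \<in> V X p a \<or> p a \<in> V Y p a \<or> p a = 0 \<and> V X p a = {} \<and> V Y p a = {}" for a
    using Max_in[of "V X p a"] Min_in[of "V Y p a"] fin(1)[of X p a] fin(1)[of Y p a] p[of a]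
    by (auto simp: step_def split: if_splits)
  have le: "f \<le> Lex p" if "f \<in> X" for f
  proof (rule ccontr)
    assume "\<not> f \<le> Lex p"
    then have "Lex p < f" by simp
    then obtain a where "\<forall>c<a. p c = app f c" "p a < app f a"
      by (auto simp: less_lexfun_def)
    then have a: "\<forall>c<a. app f c = p c" "p a < app f a" by simp_all
    then have "app f a \<in> V X p a"
      using that by (auto simp: V_def)
    then have "app f a \<le> p a"
      using fin(1)[of X p a] p[of a] by (auto simp: step_def)
    then show False using a by simp
  qed
  have ge: "Lex p \<le> f" if "f \<in> Y" for f
  proof (rule ccontr)
    assume "\<not> Lex p \<le> f"
    then have "f < Lex p" by simp
    then obtain a where a: "\<forall>c<a. app f c = p c" "app f a < p a"
      by (auto simp: less_lexfun_def)
    then have f: "app f a \<in> V Y p a"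
      using that by (auto simp: V_def)
    show False
    proof (cases "V X p a = {}")
      case True
      then have "p a \<le> app f a"
        using fin(1)[of Y p a] f p[of a] by (auto simp: step_def)
      then show False using a by simp
    next
      case False
      \<comment> \<open>The maximum is attained by some \<open>g\<close> in \<open>X\<close>, and
        \<open>f\<close> from \<open>Y\<close> would lie below it.\<close>
      then have "p a \<in> V X p a"
        using Max_in[of "V X p a"] fin(1)[of X p a] p[of a] by (auto simp: step_def)
      then obtain g where g: "g \<in> X" "\<forall>c<a. app g c = p c" "app g a = p a"
        by (auto simp: V_def)
      have "f < g"
        by (rule less_lexfunI[of a]) (use a g in auto)
      then show False
        using less[OF g(1) that] by simp
    qed
  qed
  have "app (Lex p) x \<in> {-1, 0, 1}" for x
    using p_in[of x] fin(2)[of X p x] fin(2)[of Y p x] by auto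
  moreover have "app (Lex p) x = 0" if "x \<ge> b" for x
    using p_in[of x] bounded that by (auto simp: V_def)
  ultimately show ?thesis
    using le ge by blast
qed

text \<open>Regularity bounds all supports by a common \<open>c\<close>. A cut \<open>p\<close>
  supported below \<open>c\<close> is changed at one place \<open>d\<close> with
  \<open>c \<le> d\<close> and \<open>b d = k\<close>; this becomes the last nonzero place and fixes
  the colour. Whatever differs from \<open>p\<close> already differs below \<open>c\<close>, so the
  change matters only for comparison with \<open>p\<close> itself.\<close>

lemma hausdorff_saturated:
  fixes X Y :: "'k sat_order set"
  assumes unb: "\<And>k a. \<exists>x\<ge>a. b x = k"
    and small: "X \<union> Y \<subseteq> G ` {..<a :: 'k}"
    and less: "\<And>f g. f \<in> X \<Longrightarrow> g \<in> Y \<Longrightarrow> f < g"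
  shows "\<exists>z. (\<forall>f\<in>X. f < z) \<and> (\<forall>f\<in>Y. z < f) \<and> hausdorff_colour b z = k"
proof -
  have "\<exists>c. \<forall>x\<ge>c. app (Rep_sat_order f) x = 0" for f :: "'k sat_order"
    using Rep_sat_order[of f] by blast
  then obtain s where s: "\<And>(f :: 'k sat_order) x. s f \<le> x \<Longrightarrow> app (Rep_sat_order f) x = 0"
    by metis
  obtain c where c: "\<forall>x<a. s (G x) < c"
    using bounded_image by blast
  have supp: "app (Rep_sat_order f) x = 0" if "f \<in> X \<union> Y" "c \<le> x" for f x
  proof -
    have "f \<in> G ` {..<a}" using small that(1) by (rule subsetD)
    then obtain i where "i < a" "f = G i" by auto
    then show ?thesis using c s[of f x] that by force
  qed
  have "\<exists>p. (\<forall>x. app p x \<in> {-1, 0, 1}) \<and> (\<forall>x\<ge>c. app p x = 0) \<and>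
      (\<forall>f\<in>Rep_sat_order ` X. f \<le> p) \<and> (\<forall>f\<in>Rep_sat_order ` Y. p \<le> f)"
  proof (rule ex_cut)
    show "app f x \<in> {-1, 0, 1}" if "f \<in> Rep_sat_order ` X \<union> Rep_sat_order ` Y" for f x
      using that Rep_sat_order by blast
    show "f < g" if "f \<in> Rep_sat_order ` X" "g \<in> Rep_sat_order ` Y" for f g
      using that less by (auto simp: less_sat_order_def)
    show "app f x = 0" if "f \<in> Rep_sat_order ` X \<union> Rep_sat_order ` Y" "c \<le> x" for f x
      using that supp by blast
  qed
  then obtain p where p': "\<forall>x. app p x \<in> {-1, 0, 1}" "\<forall>x\<ge>c. app p x = 0"
    "\<forall>f\<in>Rep_sat_order ` X. f \<le> p" "\<forall>f\<in>Rep_sat_order ` Y. p \<le> f"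
    by (elim exE conjE)
  have p: "\<And>x. app p x \<in> {-1, 0, 1}" "\<And>x. c \<le> x \<Longrightarrow> app p x = 0"
    "\<And>f. f \<in> X \<Longrightarrow> Rep_sat_order f \<le> p" "\<And>f. f \<in> Y \<Longrightarrow> p \<le> Rep_sat_order f"
    using p' by (simp_all only: ball_simps)
  obtain d where d: "c \<le> d" "b d = k"
    using unb by blast
  \<comment> \<open>If \<open>p\<close> belongs to \<open>Y\<close>, the new element must go below
    it; otherwise it goes above, as is required when \<open>p\<close> belongs to \<open>X\<close>.
    Both cannot happen, since \<open>X\<close> lies strictly below \<open>Y\<close>.\<close>
  define e :: int where "e = (if p \<in> Rep_sat_order ` Y then -1 else 1)"
  define z where "z = Abs_sat_order (Lex ((app p)(d := e)))"
  obtain d' where d': "d < d'" using ex_greater by blast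
  have "Lex ((app p)(d := e)) \<in> {f. range (app f) \<subseteq> {-1, 0, 1} \<and> (\<exists>a. \<forall>x\<ge>a. app f x = 0)}"
    using p(1,2) d d' by (force simp: e_def intro!: exI[of _ d'])
  then have z: "Rep_sat_order z = Lex ((app p)(d := e))"
    unfolding z_def by (rule Abs_sat_order_inverse)
  have "(THE c. app (Rep_sat_order z) c \<noteq> 0 \<and> (\<forall>x>c. app (Rep_sat_order z) x = 0)) = d"
  proof (rule the_equality)
    show "app (Rep_sat_order z) d \<noteq> 0 \<and> (\<forall>x>d. app (Rep_sat_order z) x = 0)"
      using p(2) d by (auto simp: z e_def)
  next
    fix c'
    assume *: "app (Rep_sat_order z) c' \<noteq> 0 \<and> (\<forall>x>c'. app (Rep_sat_order z) x = 0)"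
    show "c' = d"
    proof (rule linorder_cases[of c' d])
      assume "c' < d"
      then show ?thesis using * by (auto simp: z e_def split: if_splits)
    next
      assume "d < c'"
      moreover have "app p c' = 0" using p(2) \<open>d < c'\<close> d(1) by simp
      ultimately show ?thesis using * by (auto simp: z split: if_splits)
    qed
  qed
  then have colour: "hausdorff_colour b z = k"
    using d by (simp add: hausdorff_colour_def)
  have pd: "app p d = 0" using p(2) d by simp
  have trans: "f < z" if "Rep_sat_order f < p" "f \<in> X \<union> Y" for f
  proof -
    obtain x where x: "\<And>b. b < x \<Longrightarrow> app (Rep_sat_order f) b = app p b" "app (Rep_sat_order f) x < app p x"
      using \<open>Rep_sat_order f < p\<close> unfolding less_lexfun_def by blast
    then have "x < c" using p(2)[of x] supp[OF that(2), of x] by (cases "x < c") auto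
    then show ?thesis
      unfolding less_sat_order_def z using x d by (intro less_lexfunI[of x]) auto
  qed
  have trans': "z < f" if "p < Rep_sat_order f" "f \<in> X \<union> Y" for f
  proof -
    obtain x where x: "\<And>b. b < x \<Longrightarrow> app p b = app (Rep_sat_order f) b" "app p x < app (Rep_sat_order f) x"
      using \<open>p < Rep_sat_order f\<close> unfolding less_lexfun_def by blast
    then have "x < c" using p(2)[of x] supp[OF that(2), of x] by (cases "x < c") auto
    then show ?thesis
      unfolding less_sat_order_def z using x d by (intro less_lexfunI[of x]) auto
  qed
  have "f < z" if "f \<in> X" for f
  proof (cases "Rep_sat_order f = p")
    case True
    then have "p \<notin> Rep_sat_order ` Y"
      using less[OF that] by (metis Rep_sat_order_inject imageE less_irrefl)
    then show ?thesis
      unfolding less_sat_order_def z using True pd by (intro less_lexfunI[of d]) (auto simp: e_def)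
  next
    case False
    then show ?thesis using trans p(3)[OF that] that by auto
  qed
  moreover have "z < f" if "f \<in> Y" for f
  proof (cases "Rep_sat_order f = p")
    case True
    then show ?thesis
      unfolding less_sat_order_def z using that pd by (intro less_lexfunI[of d]) (auto simp: e_def)
  next
    case False
    then show ?thesis using trans' p(4)[OF that] that by auto
  qed
  ultimately show ?thesis
    using colour by blast
qed

lemma inj_kseqs: "\<exists>e :: ('k \<rightharpoonup> 'k) \<Rightarrow> 'k. inj_on e kseqs"
proof -
  have "|kseqs :: ('k \<rightharpoonup> 'k) set| \<le>o |UNIV :: 'k set|"
    using kseqs_kappa card_of_UNIV_kappa ordIso_symmetric ordIso_transitive ordIso_iff_ordLeq by blast
  then show ?thesis
    using card_of_ordLeq[of "kseqs :: ('k \<rightharpoonup> 'k) set" "UNIV :: 'k set"] by blast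
qed

text \<open>An element is recovered from its restriction to a bound \<open>s f\<close> of its
  support, which is a member of \<open>kseqs\<close>. The domain of the restriction returns the
  bound, beyond which the element vanishes.\<close>

lemma inj_sat_order: "\<exists>num :: 'k sat_order \<Rightarrow> 'k. inj num"
proof -
  obtain e :: "('k \<rightharpoonup> 'k) \<Rightarrow> 'k" where e: "inj_on e kseqs"
    using inj_kseqs by blast
  obtain n :: "nat \<Rightarrow> 'k" where n: "inj n"
    using infinite_UNIV_kappa infinite_countable_subset by blast
  define m where "m x = n (nat (x + 1))" for x :: int
  have m: "m x = m y \<Longrightarrow> x = y" if "x \<in> {-1, 0, 1}" "y \<in> {-1, 0, 1}" for x y
    using that n by (auto simp: m_def inj_eq)
  have "\<exists>c. \<forall>x\<ge>c. app (Rep_sat_order f) x = 0" for f :: "'k sat_order"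
    using Rep_sat_order[of f] by blast
  then obtain s where s: "\<And>(f :: 'k sat_order) x. s f \<le> x \<Longrightarrow> app (Rep_sat_order f) x = 0"
    by metis
  define r where "r f = (\<lambda>x. if x < s f then Some (m (app (Rep_sat_order f) x)) else None)"
    for f :: "'k sat_order"
  have "r f \<in> kseqs" for f
    by (auto simp: kseqs_def r_def dom_def intro!: exI[of _ "s f"] split: if_splits)
  moreover have "f = g" if "r f = r g" for f g
  proof -
    have sgn: "app (Rep_sat_order h) x \<in> {-1, 0, 1}" for h :: "'k sat_order" and x
      using Rep_sat_order[of h] by blast
    have "dom (r h) = {..<s h}" for h
      by (auto simp: r_def dom_def split: if_splits)
    then have *: "x < s f \<longleftrightarrow> x < s g" for x
      using that by (metis lessThan_iff)
    have "app (Rep_sat_order f) x = app (Rep_sat_order g) x" for x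
    proof (cases "x < s f")
      case True
      have "r f x = r g x" using that by simp
      then have "m (app (Rep_sat_order f) x) = m (app (Rep_sat_order g) x)"
        using True *[of x] by (simp add: r_def)
      then show ?thesis by (rule m[OF sgn sgn])
    next
      case False
      then show ?thesis using s[of f x] s[of g x] *[of x] by simp
    qed
    then have "Rep_sat_order f = Rep_sat_order g"
      by (rule lexfun_eqI)
    then show "f = g"
      by (simp add: Rep_sat_order_inject)
  qed
  ultimately have "inj (e \<circ> r)"
    using e by (auto simp: inj_on_def)
  then show ?thesis by blast
qed

lemma ex_saturated_order:
  "\<exists>col num. saturated_order (col :: 'k sat_order \<Rightarrow> 'k) num"
proof -
  obtain b :: "'k \<Rightarrow> 'k" where b: "\<And>k a. \<exists>x\<ge>a. b x = k"
    using ex_unbounded_fibres by blast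
  obtain num :: "'k sat_order \<Rightarrow> 'k" where num: "inj num"
    using inj_sat_order by blast
  have "saturated_order (hausdorff_colour b) num"
    by unfold_locales (use hausdorff_saturated[OF b] num in blast)+
  then show ?thesis by blast
qed

end

section \<open>Back and forth on a saturated order\<close>

context saturated_order
begin

lemma saturated_finite:
  assumes "finite X" "finite Y" "\<And>x y. x \<in> X \<Longrightarrow> y \<in> Y \<Longrightarrow> x < y"
  shows "\<exists>z. (\<forall>x\<in>X. x < z) \<and> (\<forall>y\<in>Y. z < y) \<and> col z = k"
proof -
  have "\<exists>G a. X \<union> Y \<subseteq> G ` {..<a :: 'k}"
    using finite_UnI[OF assms(1,2)]
  proof (induction "X \<union> Y" arbitrary: X Y rule: finite_induct)
    case empty
    then show ?case by blast
  next
    case (insert x F)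
    obtain G and a :: 'k where Ga: "F \<subseteq> G ` {..<a}"
      using insert.hyps(3)[of F "{}"] by auto
    obtain b where b: "a < b" using ex_greater by blast
    have "insert x F \<subseteq> (G(a := x)) ` {..<b}"
    proof -
      have "x \<in> (G(a := x)) ` {..<b}" using b by (intro image_eqI[of _ _ a]) auto
      moreover have "y \<in> (G(a := x)) ` {..<b}" if "y \<in> F" for y
      proof -
        have "y \<in> G ` {..<a}" using Ga that by (rule subsetD)
        then obtain i where "i < a" "y = G i" by auto
        then show ?thesis using b by (intro image_eqI[of _ _ i]) auto
      qed
      ultimately show ?thesis by blast
    qed
    then show ?case using insert.hyps by metis
  qed
  then show ?thesis using saturated assms(3) by blast
qed

lemma ex_col: "\<exists>x. col x = k"
  using saturated_finite[of "{}" "{}"] by auto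

lemma ex_between: "x < y \<Longrightarrow> \<exists>z. x < z \<and> z < y \<and> col z = k"
  using saturated_finite[of "{x}" "{y}"] by auto

lemma ex_above: "\<exists>z. (x :: 'q) < z"
  using saturated_finite[of "{x}" "{}"] by auto

lemma ex_below: "\<exists>z. z < (x :: 'q)"
  using saturated_finite[of "{}" "{x}"] by auto

text \<open>Every interval meets all colours, of which there are uncountably many.\<close>

lemma uncountable_interval: "x < y \<Longrightarrow> \<not> countable {x<..<y :: 'q}"
proof
  assume "x < y" "countable {x<..<y}"
  then have "countable (col ` {x<..<y})" by blast
  moreover have "col ` {x<..<y} = UNIV"
  proof -
    have "k \<in> col ` {x<..<y}" for k
    proof -
      obtain z where "x < z" "z < y" "col z = k"
        using ex_between[OF \<open>x < y\<close>] by blast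
      then show ?thesis by auto
    qed
    then show ?thesis by blast
  qed
  ultimately show False using uncountable_UNIV by simp
qed

text \<open>One step of the back-and-forth: \<open>x\<close> cuts the values of \<open>u\<close>,
  and the corresponding cut in the values of \<open>v\<close> is filled with the colour dictated by
  \<open>g\<close>. If \<open>x\<close> is already some \<open>u b\<close>, its partner
  \<open>v b\<close> is the only choice.\<close>

lemma saturated_extend:
  fixes u v :: "'k \<Rightarrow> 'q"
  assumes "\<And>b c. b < a \<Longrightarrow> c < a \<Longrightarrow> u b < u c \<longleftrightarrow> v b < v c"
    and "\<And>b. b < a \<Longrightarrow> col (v b) = g (col (u b))"
  shows "\<exists>y. col y = g (col x) \<and> (\<forall>b<a. (u b < x \<longleftrightarrow> v b < y) \<and> (x < u b \<longleftrightarrow> y < v b))"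
proof (cases "\<exists>b<a. u b = x")
  case True
  then show ?thesis using assms by blast
next
  case False
  define X where "X = v ` {b. b < a \<and> u b < x}"
  define Y where "Y = v ` {b. b < a \<and> x < u b}"
  have "\<exists>y. (\<forall>z\<in>X. z < y) \<and> (\<forall>z\<in>Y. y < z) \<and> col y = g (col x)"
  proof (rule saturated)
    show "X \<union> Y \<subseteq> v ` {..<a}" by (auto simp: X_def Y_def)
    fix w z
    assume "w \<in> X" "z \<in> Y"
    then obtain b c where bc: "b < a" "u b < x" "w = v b" "c < a" "x < u c" "z = v c"
      by (auto simp: X_def Y_def)
    then have "u b < u c" by simp
    then show "w < z"
      using bc assms(1) by simp
  qed
  then obtain y where y: "\<And>b. b < a \<Longrightarrow> u b < x \<Longrightarrow> v b < y" "\<And>b. b < a \<Longrightarrow> x < u b \<Longrightarrow> y < v b" "col y = g (col x)"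
    by (auto simp: X_def Y_def)
  show ?thesis
  proof (intro exI[of _ y] conjI allI impI)
    fix b assume b: "b < a"
    show "u b < x \<longleftrightarrow> v b < y" "x < u b \<longleftrightarrow> y < v b"
      using y(1,2)[OF b] False b by (metis less_asym linorder_neqE)+
  qed (rule y)
qed

text \<open>A single recursion of length \<kappa>: stage \<open>a\<close> places the element named
  by \<open>task a\<close> in the domain (\<open>Inl\<close>) or in the range (\<open>Inr\<close>).
  Fewer than \<kappa> pairs precede it, also at limits, so saturation supplies the partner.\<close>

lemma lift_permutation:
  assumes h: "bij h"
  shows "\<exists>H. bij H \<and> strict_mono (H :: 'q \<Rightarrow> 'q) \<and> (\<forall>x. col (H x) = h (col x))"
proof -
  obtain m :: "'k \<Rightarrow> 'k + 'k" where m: "surj m" using surj_sum by blast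
  define task where "task a = map_sum (inv num) (inv num) (m a)" for a
  have task: "\<exists>a. task a = x" for x
  proof -
    obtain a where "m a = map_sum num num x" using m by (metis surjD)
    then have "task a = x" by (cases x) (auto simp: task_def inj_num)
    then show ?thesis by blast
  qed
  define good where "good f a p \<longleftrightarrow> col (snd p) = h (col (fst p)) \<and>
      (\<forall>b<a. (fst (f b) < fst p \<longleftrightarrow> snd (f b) < snd p) \<and> (fst p < fst (f b) \<longleftrightarrow> snd p < snd (f b))) \<and>
      (case task a of Inl x \<Rightarrow> fst p = x | Inr x \<Rightarrow> snd p = x)" for f :: "'k \<Rightarrow> 'q \<times> 'q" and a p
  have "\<exists>f. \<forall>a. good f a (f a)"
  proof (rule dependent_wf_choice[OF wf])
    fix f g :: "'k \<Rightarrow> 'q \<times> 'q" and x r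
    assume *: "\<And>z. (z, x) \<in> {(y, x). y < x} \<Longrightarrow> f z = g z"
    then show "good f x r = good g x r"
      by (simp add: good_def)
  next
    fix a and f :: "'k \<Rightarrow> 'q \<times> 'q"
    assume "\<And>b. (b, a) \<in> {(y, x). y < x} \<Longrightarrow> good f b (f b)"
    then have IH: "good f b (f b)" if "b < a" for b using that by simp
    have mono: "fst (f b) < fst (f c) \<longleftrightarrow> snd (f b) < snd (f c)" if "b < a" "c < a" for b c
      using IH[OF that(1)] IH[OF that(2)] by (cases b c rule: linorder_cases) (auto simp: good_def)
    have colf: "col (snd (f b)) = h (col (fst (f b)))" if "b < a" for b
      using IH[OF that] by (simp add: good_def)
    show "\<exists>p. good f a p"
    proof (cases "task a")
      case (Inl x)
      obtain y where "col y = h (col x)"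
        "\<forall>b<a. (fst (f b) < x \<longleftrightarrow> snd (f b) < y) \<and> (x < fst (f b) \<longleftrightarrow> y < snd (f b))"
        using saturated_extend[of a "\<lambda>b. fst (f b)" "\<lambda>b. snd (f b)" h x] mono colf by blast
      then have "good f a (x, y)" using Inl by (simp add: good_def)
      then show ?thesis by blast
    next
      case (Inr y)
      \<comment> \<open>The backward step is the forward one with the roles exchanged, so colours
        are moved by the inverse permutation.\<close>
      have "col (fst (f b)) = inv h (col (snd (f b)))" if "b < a" for b
        using colf[OF that] h by (simp add: bij_is_inj)
      then obtain x where "col x = inv h (col y)"
        "\<forall>b<a. (snd (f b) < y \<longleftrightarrow> fst (f b) < x) \<and> (y < snd (f b) \<longleftrightarrow> x < fst (f b))"
        using saturated_extend[of a "\<lambda>b. snd (f b)" "\<lambda>b. fst (f b)" "inv h" y] mono by blast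
      then have "good f a (x, y)" using Inr h by (simp add: good_def bij_is_surj surj_f_inv_f)
      then show ?thesis by blast
    qed
  qed
  then obtain f where f: "\<And>a. good f a (f a)" by blast
  have mono: "fst (f b) < fst (f c) \<longleftrightarrow> snd (f b) < snd (f c)" for b c
    using f[of b] f[of c] by (cases b c rule: linorder_cases) (auto simp: good_def)
  have eq: "fst (f b) = fst (f c) \<longleftrightarrow> snd (f b) = snd (f c)" for b c
    using mono[of b c] mono[of c b] by (metis less_irrefl linorder_neqE)
  have "\<exists>a. fst (f a) = x" for x
  proof -
    obtain a where "task a = Inl x" using task by blast
    then show ?thesis using f[of a] by (auto simp: good_def)
  qed
  then obtain i where i: "\<And>x. fst (f (i x)) = x" by metis
  have sur: "\<exists>a. snd (f a) = x" for x
  proof -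
    obtain a where "task a = Inr x" using task by blast
    then show ?thesis using f[of a] by (auto simp: good_def)
  qed
  define H where "H x = snd (f (i x))" for x
  have "strict_mono H"
    using mono i by (metis H_def strict_monoI)
  moreover have "\<exists>x. y = H x" for y
  proof -
    obtain a where "snd (f a) = y" using sur by blast
    moreover have "snd (f (i (fst (f a)))) = snd (f a)"
      using eq[of "i (fst (f a))" a] i by simp
    ultimately show ?thesis unfolding H_def by metis
  qed
  then have "surj H" by (simp add: surj_def)
  moreover have "col (H x) = h (col x)" for x
    using f[of "i x"] i by (simp add: H_def good_def)
  moreover have "inj H"
    using \<open>strict_mono H\<close> by (rule strict_mono_imp_inj_on)
  ultimately show ?thesis
    unfolding bij_def by blast
qed

end

section \<open>Order isomorphisms between sets\<close>

definition order_iso_on :: "('a::linorder \<Rightarrow> 'b::linorder) \<Rightarrow> 'a set \<Rightarrow> 'b set \<Rightarrow> bool" where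
  "order_iso_on f X Y \<longleftrightarrow> bij_betw f X Y \<and> strict_mono_on X f"

lemma order_iso_onI:
  "(\<And>x y. x \<in> X \<Longrightarrow> y \<in> X \<Longrightarrow> x < y \<Longrightarrow> f x < f y) \<Longrightarrow> f ` X = Y \<Longrightarrow> order_iso_on f X Y"
  unfolding order_iso_on_def
  by (auto simp: bij_betw_def strict_mono_on_def intro!: strict_mono_on_imp_inj_on)

lemma order_iso_on_less_iff:
  "order_iso_on f X Y \<Longrightarrow> x \<in> X \<Longrightarrow> y \<in> X \<Longrightarrow> f x < f y \<longleftrightarrow> x < y"
  unfolding order_iso_on_def using strict_mono_on_less by blast

lemma order_iso_on_in: "order_iso_on f X Y \<Longrightarrow> x \<in> X \<Longrightarrow> f x \<in> Y"
  by (auto simp: order_iso_on_def bij_betw_def)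

lemma order_iso_on_eq_iff:
  "order_iso_on f X Y \<Longrightarrow> x \<in> X \<Longrightarrow> y \<in> X \<Longrightarrow> f x = f y \<longleftrightarrow> x = y"
  by (auto simp: order_iso_on_def bij_betw_def inj_on_def)

lemma order_iso_on_le_iff:
  "order_iso_on f X Y \<Longrightarrow> x \<in> X \<Longrightarrow> y \<in> X \<Longrightarrow> f x \<le> f y \<longleftrightarrow> x \<le> y"
  using order_iso_on_less_iff[of f X Y y x] by (simp add: not_less[symmetric])

lemma order_iso_on_surj: "order_iso_on f X Y \<Longrightarrow> y \<in> Y \<Longrightarrow> \<exists>x\<in>X. y = f x"
  by (auto simp: order_iso_on_def bij_betw_def)

lemma order_iso_on_image: "order_iso_on f X Y \<Longrightarrow> f ` X = Y"
  by (simp add: order_iso_on_def bij_betw_def)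

lemma order_iso_on_interval:
  assumes "order_iso_on f X Y" "x \<in> X" "y \<in> X"
  shows "{z \<in> Y. f x < z \<and> z < f y} = f ` {z \<in> X. x < z \<and> z < y}"
  using assms order_iso_on_less_iff[OF assms(1)] order_iso_on_surj[OF assms(1)] order_iso_on_in[OF assms(1)]
  by (auto simp: image_iff) metis

section \<open>The order of a structure\<close>

text \<open>Three countable dense orders, told apart by their end points.\<close>

definition cell :: "nat \<Rightarrow> rat set" where
  "cell m = (if m = 0 then UNIV else if m = 1 then {0..} else {..0})"

lemma zero_in_cell [simp]: "0 \<in> cell m"
  by (simp add: cell_def)

lemma cell_least_iff: "m \<le> 2 \<Longrightarrow> (\<exists>x\<in>cell m. \<forall>y\<in>cell m. x \<le> y) \<longleftrightarrow> m = 1"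
proof -
  have "\<not> (\<exists>x. \<forall>y. x \<le> (y :: rat))" by (meson lt_ex not_le)
  moreover have "\<not> (\<exists>x\<le>0. \<forall>y\<le>0. x \<le> (y :: rat))"
    by (metis lt_ex not_le order_less_le_trans order_less_imp_le)
  moreover assume "m \<le> 2"
  then have "m = 0 \<or> m = 1 \<or> m = 2" by auto
  ultimately show ?thesis by (auto simp: cell_def)
qed

lemma cell_greatest_iff: "m \<le> 2 \<Longrightarrow> (\<exists>x\<in>cell m. \<forall>y\<in>cell m. y \<le> x) \<longleftrightarrow> m = 2"
proof -
  have "\<not> (\<exists>x. \<forall>y. y \<le> (x :: rat))" by (meson gt_ex not_le)
  moreover have "\<not> (\<exists>x\<ge>0. \<forall>y\<ge>0. y \<le> (x :: rat))"
    by (metis gt_ex not_le order_le_less_trans order_less_imp_le)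
  moreover assume "m \<le> 2"
  then have "m = 0 \<or> m = 1 \<or> m = 2" by auto
  ultimately show ?thesis by (auto simp: cell_def)
qed

lemma order_iso_on_cell:
  assumes f: "order_iso_on f (cell m) (cell n)" and mn: "m \<le> 2" "n \<le> 2"
  shows "m = n"
proof -
  have all: "(\<forall>y\<in>cell n. P y) \<longleftrightarrow> (\<forall>y\<in>cell m. P (f y))" for P
    by (simp add: order_iso_on_image[OF f, symmetric])
  have ex: "(\<exists>y\<in>cell n. P y) \<longleftrightarrow> (\<exists>y\<in>cell m. P (f y))" for P
    by (simp add: order_iso_on_image[OF f, symmetric])
  have "(\<exists>x\<in>cell m. \<forall>y\<in>cell m. x \<le> y) \<longleftrightarrow> (\<exists>x\<in>cell n. \<forall>y\<in>cell n. x \<le> y)"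
    unfolding all ex using order_iso_on_le_iff[OF f] by blast
  moreover have "(\<exists>x\<in>cell m. \<forall>y\<in>cell m. y \<le> x) \<longleftrightarrow> (\<exists>x\<in>cell n. \<forall>y\<in>cell n. y \<le> x)"
    unfolding all ex using order_iso_on_le_iff[OF f] by blast
  ultimately show ?thesis
    using mn by (auto simp: cell_least_iff cell_greatest_iff)
qed

text \<open>Pairs are compared lexicographically, and \<open>None\<close> is the least option. Hence
  in a key the middle entry \<open>None\<close>, which stands for the cell, precedes all
  \<open>Some u\<close>, which stand for the copy of the saturated order.\<close>

type_synonym ('k, 'q) point = "('k, 'q option) lexfun \<times> 'k option"
type_synonym ('k, 'q) key = "('k, 'q) point \<times> ('q option \<times> rat)"

text \<open>\<open>idx\<close> lists the atomic formulas along a block. Surjectivity ensures that a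
  block records the whole atomic type; repetitions do no harm.\<close>

locale structure_order = saturated_order K col num
  for K :: "'k::wellorder itself" and col :: "'q::linorder \<Rightarrow> 'k" and num :: "'q \<Rightarrow> 'k" +
  fixes idx :: "'k \<Rightarrow> nat \<times> 'k list"
  assumes surj_idx: "surj idx"
begin

text \<open>A sequence extends its proper initial segments in the lexicographic order, because
  \<open>None\<close> is the least element of the option type.\<close>

definition seqs :: "('k, 'q option) lexfun set" where
  "seqs = {s. \<exists>a. dom (app s) = {..<a}}"

definition colour_at :: "('k, 'q option) lexfun \<Rightarrow> 'k \<Rightarrow> 'k" where
  "colour_at s x = col (the (app s x))"

text \<open>Index \<open>0\<close> stands for equality, index \<open>n + 1\<close> for the relation symbol \<open>n\<close>.\<close>

definition atomic_type :: "'k struct \<Rightarrow> ('k, 'q option) lexfun \<Rightarrow> nat \<times> 'k list \<Rightarrow> bool" where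
  "atomic_type A s i \<longleftrightarrow> set (snd i) \<subseteq> dom (app s) \<and>
     (case fst i of 0 \<Rightarrow> \<exists>x y. snd i = [x, y] \<and> colour_at s x = colour_at s y
      | Suc n \<Rightarrow> (n, map (colour_at s) (snd i)) \<in> A)"

text \<open>Each sequence is followed by a well-ordered block: a start point \<open>None\<close>, and then a point
  for every atomic formula.\<close>

definition points :: "('k, 'q) point set" where
  "points = seqs \<times> UNIV"

text \<open>The value 2 is reserved for start points, so that an isomorphism cannot confuse them
  with bits; 0 and 1 are truth values.\<close>

definition mark :: "'k struct \<Rightarrow> ('k, 'q) point \<Rightarrow> nat" where
  "mark A p = (case snd p of None \<Rightarrow> 2 | Some j \<Rightarrow> if atomic_type A (fst p) (idx j) then 1 else 0)"

text \<open>Each point is replaced by its cell, followed by a copy of the saturated order, which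
  separates the cells by uncountable intervals.\<close>

definition keys :: "'k struct \<Rightarrow> ('k, 'q) key set" where
  "keys A = {(p, e, r). p \<in> points \<and> (if e = None then r \<in> cell (mark A p) else r = 0)}"

lemma mark_le: "mark A p \<le> 2"
  by (simp add: mark_def split: option.split)

section \<open>Density and absence of end points\<close>

lemma keys_dense:
  assumes "x \<in> keys A" "y \<in> keys A" "x < y"
  shows "\<exists>z\<in>keys A. x < z \<and> z < y"
proof -
  obtain p e r where x: "x = (p, e, r)" by (cases x)
  obtain p' e' r' where y: "y = (p', e', r')" by (cases y)
  have p: "p \<in> points" and p': "p' \<in> points" using assms by (auto simp: x y keys_def)
  consider "p < p'" | "p = p'" "e < e'" | "p = p'" "e = e'" "r < r'"
    using assms(3) by (auto simp: x y order_le_less)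
  then show ?thesis
  proof cases
    case 1
    \<comment> \<open>The copy that follows the cell of \<open>p\<close> has no last element, so it
      contains something above \<open>x\<close>, still below everything at
      \<open>p'\<close>.\<close>
    obtain u where "e < Some u"
      using ex_above by (cases e) auto
    then show ?thesis
      using 1 p by (intro bexI[of _ "(p, Some u, 0)"]) (auto simp: x y keys_def)
  next
    case 2
    then obtain u' where u': "e' = Some u'" by (cases e'; cases e) auto
    obtain u where "e < Some u" "u < u'"
    proof (cases e)
      case None
      then show ?thesis using ex_below[of u'] that by auto
    next
      case (Some v)
      then show ?thesis using ex_between[of v u'] that 2 u' by auto
    qed
    then show ?thesis
      using 2 u' p by (intro bexI[of _ "(p, Some u, 0)"]) (auto simp: x y keys_def)
  next
    case 3
    then have e: "e = None" using assms by (auto simp: x y keys_def split: if_splits)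
    have "r \<in> cell (mark A p)" "r' \<in> cell (mark A p)"
      using assms 3 e by (auto simp: x y keys_def)
    then have "(r + r') / 2 \<in> cell (mark A p)"
      by (auto simp: cell_def split: if_splits)
    then show ?thesis
      using 3 e p by (intro bexI[of _ "(p, None, (r + r') / 2)"]) (auto simp: x y keys_def)
  qed
qed

lemma keys_above:
  assumes "x \<in> keys A"
  shows "\<exists>z\<in>keys A. x < z"
proof -
  obtain p e r where x: "x = (p, e, r)" by (cases x)
  obtain u where "e < Some u" using ex_above by (cases e) auto
  then show ?thesis
    using assms by (intro bexI[of _ "(p, Some u, 0)"]) (auto simp: x keys_def)
qed

text \<open>The critical case is the start point of a block, above all that of the empty sequence,
  the least point. Its mark 2 gives a cell without least element; mark 1 there would create a left
  end point.\<close>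

lemma keys_below:
  assumes "x \<in> keys A"
  shows "\<exists>z\<in>keys A. z < x"
proof -
  obtain s j e r where x: "x = ((s, j), e, r)" by (cases x; cases "fst x") auto
  consider u where "e = Some u" | i where "j = Some i" | "e = None" "j = None"
    by (cases e; cases j) auto
  then show ?thesis
  proof cases
    case 1
    obtain v where "v < u" using ex_below by blast
    then show ?thesis
      using assms 1 by (intro bexI[of _ "((s, j), Some v, 0)"]) (auto simp: x keys_def)
  next
    case 2
    then show ?thesis
      using assms by (intro bexI[of _ "((s, None), None, 0)"]) (auto simp: x keys_def points_def)
  next
    case 3
    then show ?thesis
      using assms by (intro bexI[of _ "((s, None), None, r - 1)"])
        (auto simp: x keys_def mark_def cell_def)
  qed
qed

section \<open>Recovering the cells and their marks from the order\<close>

definition cellmates :: "('k, 'q) key \<Rightarrow> ('k, 'q) key \<Rightarrow> bool" where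
  "cellmates x y \<longleftrightarrow> fst x = fst y \<and> fst (snd x) = None \<and> fst (snd y) = None"

lemma uncountable_copy:
  assumes "p \<in> points" "u < v" "x < (p, Some u, 0) \<or> x = (p, Some u, 0)" "(p, Some v, 0) < y \<or> (p, Some v, 0) = y"
  shows "\<not> countable {z \<in> keys A. x < z \<and> z < y}"
proof
  assume "countable {z \<in> keys A. x < z \<and> z < y}"
  moreover have "(\<lambda>w. (p, Some w, 0)) ` {u<..<v} \<subseteq> {z \<in> keys A. x < z \<and> z < y}"
  proof
    fix z :: "('k, 'q) key" assume "z \<in> (\<lambda>w. (p, Some w, 0)) ` {u<..<v}"
    then obtain w where w: "z = (p, Some w, 0)" "u < w" "w < v" by auto
    then have "(p, Some u, 0) < z" "z < (p, Some v, 0)" by auto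
    then show "z \<in> {z \<in> keys A. x < z \<and> z < y}"
      using assms w by (auto simp: keys_def simp del: less_prod_simp)
  qed
  ultimately have "countable ((\<lambda>w. (p, Some w, 0 :: rat)) ` {u<..<v})"
    by (rule countable_subset[rotated])
  moreover have "inj_on (\<lambda>w. (p, Some w, 0 :: rat)) {u<..<v}"
    by (auto simp: inj_on_def)
  ultimately have "countable {u<..<v}"
    by (rule countable_image_inj_on)
  then show False using uncountable_interval assms(2) by blast
qed

text \<open>Between two keys outside a common cell there is an interval of some copy of the
  saturated order, which is uncountable, while a cell consists of rationals. This makes lying in a
  common cell a property of the order.\<close>

lemma countable_between_iff:
  assumes "x \<in> keys A" "y \<in> keys A" "x < y"
  shows "countable {z \<in> keys A. x < z \<and> z < y} \<longleftrightarrow> cellmates x y"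
proof -
  obtain p e r where x: "x = (p, e, r)" by (cases x)
  obtain p' e' r' where y: "y = (p', e', r')" by (cases y)
  have p: "p \<in> points" and p': "p' \<in> points" using assms by (auto simp: x y keys_def)
  have re: "r = 0" if "e \<noteq> None"
    using that assms by (auto simp: x keys_def)
  have re': "r' = 0" if "e' \<noteq> None"
    using that assms by (auto simp: y keys_def)
  consider "p < p'" | "p = p'" "e < e'" | "p = p'" "e = e'" "r < r'"
    using assms(3) by (auto simp: x y order_le_less)
  then show ?thesis
  proof cases
    case 1
    obtain u where u: "e < Some u" using ex_above by (cases e) auto
    obtain v where v: "u < v" using ex_above by blast
    have "\<not> countable {z \<in> keys A. x < z \<and> z < y}"
      by (rule uncountable_copy[OF p v]) (use 1 u in \<open>auto simp: x y\<close>)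
    then show ?thesis using 1 by (auto simp: cellmates_def x y)
  next
    case 2
    then obtain v where v: "e' = Some v" by (cases e'; cases e) auto
    have "\<exists>u<v. e \<le> Some u" 
    proof (cases e)
      case None
      then show ?thesis using ex_below[of v] by auto
    next
      case (Some u)
      then show ?thesis using 2 v by auto
    qed
    then obtain u where u: "u < v" "e \<le> Some u" by blast
    have "x < (p, Some u, 0) \<or> x = (p, Some u, 0)"
      using u(2) re by (cases e) (auto simp: x less_eq_option_def order_le_less)
    then have "\<not> countable {z \<in> keys A. x < z \<and> z < y}"
      by (rule uncountable_copy[OF p u(1)]) (use 2 v re' in \<open>auto simp: x y\<close>)
    then show ?thesis using 2 v by (auto simp: cellmates_def x y)
  next
    case 3
    then have e: "e = None" using re re' by (cases e) auto
    have "{z \<in> keys A. x < z \<and> z < y} \<subseteq> {p} \<times> {None} \<times> UNIV"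
    proof
      fix z assume z: "z \<in> {z \<in> keys A. x < z \<and> z < y}"
      obtain q f t where "z = (q, f, t)" by (cases z)
      then show "z \<in> {p} \<times> {None} \<times> UNIV"
        using z 3 e by (cases f) (auto simp: x y)
    qed
    moreover have "countable ({p} \<times> {None :: 'q option} \<times> (UNIV :: rat set))"
      by (intro countable_SIGMA) auto
    ultimately have "countable {z \<in> keys A. x < z \<and> z < y}"
      by (rule countable_subset)
    then show ?thesis using 3 e by (simp add: cellmates_def x y)
  qed
qed

lemma order_iso_cellmates:
  assumes F: "order_iso_on F (keys A) (keys B)" and x: "x \<in> keys A" and y: "y \<in> keys A" and "x \<noteq> y"
  shows "cellmates (F x) (F y) \<longleftrightarrow> cellmates x y"
proof -
  have less: "cellmates (F u) (F v) \<longleftrightarrow> cellmates u v" if uv: "u \<in> keys A" "v \<in> keys A" "u < v" for u v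
  proof -
    have "inj_on F {z \<in> keys A. u < z \<and> z < v}"
      using F by (auto simp: order_iso_on_def bij_betw_def inj_on_def)
    then have "countable {z \<in> keys B. F u < z \<and> z < F v} \<longleftrightarrow> countable {z \<in> keys A. u < z \<and> z < v}"
      unfolding order_iso_on_interval[OF F uv(1,2)] using countable_image_inj_on by blast
    moreover have "F u < F v"
      using order_iso_on_less_iff[OF F] uv by simp
    ultimately show ?thesis
      using countable_between_iff[OF uv] countable_between_iff[of "F u" B "F v"] order_iso_on_in[OF F] uv by simp
  qed
  have sym: "cellmates u v \<longleftrightarrow> cellmates v u" for u v :: "('k, 'q) key"
    by (auto simp: cellmates_def)
  show ?thesis
    using less[OF x y] less[OF y x] \<open>x \<noteq> y\<close> sym by (metis linorder_neqE)
qed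

text \<open>Elements of cells are those with a distinct cellmate, so cells are mapped onto cells.
  This induces a map of points, and its restriction to each cell shows that marks agree.\<close>

lemma points_order_iso:
  assumes F: "order_iso_on F (keys A) (keys B)"
  shows "\<exists>f. order_iso_on f points points \<and> (\<forall>p\<in>points. mark B (f p) = mark A p)"
proof -
  \<comment> \<open>The rational 0 lies in every cell and so can represent the cell of any
    point.\<close>
  define f where "f p = fst (F (p, None, 0))" for p
  have key0: "(p, None, 0) \<in> keys A" if "p \<in> points" for p A
    using that by (simp add: keys_def)
  have other: "\<exists>r. r \<noteq> 0 \<and> r \<in> cell m" for m
    by (cases "m = 1") (auto simp: cell_def intro: exI[of _ 1] exI[of _ "-1"])
  have F0: "fst (snd (F (p, None, 0))) = None" if p: "p \<in> points" for p
  proof -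
    obtain r where "r \<noteq> 0" "r \<in> cell (mark A p)" using other by blast
    then have "(p, None, r) \<in> keys A" "(p, None, 0) \<noteq> (p, None, r)" using p by (auto simp: keys_def)
    then have "cellmates (F (p, None, 0)) (F (p, None, r))"
      using order_iso_cellmates[OF F key0[OF p], of "(p, None, r)"] by (simp add: cellmates_def)
    then show ?thesis by (simp add: cellmates_def)
  qed
  have Fr: "F (p, None, r) = (f p, None, snd (snd (F (p, None, r))))"
    if p: "p \<in> points" and r: "r \<in> cell (mark A p)" for p r
  proof (cases "r = 0")
    case True
    then show ?thesis using F0[OF p] by (simp add: f_def prod_eq_iff)
  next
    case False
    have "(p, None, r) \<in> keys A" using p r by (simp add: keys_def)
    then have "cellmates (F (p, None, 0)) (F (p, None, r))"
      using order_iso_cellmates[OF F key0[OF p], of "(p, None, r)"] False by (simp add: cellmates_def)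
    then show ?thesis by (simp add: cellmates_def f_def prod_eq_iff)
  qed
  have f_in: "f p \<in> points" if "p \<in> points" for p
    using order_iso_on_in[OF F key0[OF that]] by (auto simp: f_def keys_def)
  have pre: "\<exists>r\<in>cell (mark A p). F (p, None, r) = (f p, None, r')"
    if p: "p \<in> points" and r': "r' \<in> cell (mark B (f p))" for p r'
  proof -
    have "(f p, None, r') \<in> keys B" using f_in[OF p] r' by (simp add: keys_def)
    then obtain x where x: "x \<in> keys A" "(f p, None, r') = F x"
      using order_iso_on_surj[OF F] by blast
    have "x = (p, None, 0) \<or> cellmates (p, None, 0) x"
    proof (cases "x = (p, None, 0)")
      case False
      have "cellmates (F (p, None, 0)) (F x)"
        using F0[OF p] x(2)[symmetric] by (simp add: cellmates_def f_def)
      then show ?thesis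
        using order_iso_cellmates[OF F key0[OF p] x(1)] False by simp
    qed simp
    then obtain r where "x = (p, None, r)" by (cases x) (auto simp: cellmates_def)
    then show ?thesis using x by (auto simp: keys_def)
  qed
  have "order_iso_on f points points"
  proof (rule order_iso_onI)
    fix p q assume pq: "p \<in> points" "q \<in> points" "p < q"
    then have "(p, None, 0) < (q, None :: 'q option, 0 :: rat)" by simp
    then have less: "F (p, None, 0) < F (q, None, 0)"
      using order_iso_on_less_iff[OF F key0[OF pq(1)] key0[OF pq(2)]] by simp
    have "\<not> cellmates (p, None, 0) (q, None, 0)" using pq(3) by (auto simp: cellmates_def)
    then have "\<not> cellmates (F (p, None, 0)) (F (q, None, 0))"
      using order_iso_cellmates[OF F key0[OF pq(1)] key0[OF pq(2)]] pq(3) by auto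
    then have "f p \<noteq> f q"
      using F0 pq by (simp add: cellmates_def f_def)
    then show "f p < f q"
      using less by (simp add: f_def less_prod_def')
  next
    have "\<exists>p\<in>points. q = f p" if q: "q \<in> points" for q
    proof -
      obtain x where x: "x \<in> keys A" "(q, None, 0) = F x"
        using order_iso_on_surj[OF F key0[OF q]] by blast
      \<comment> \<open>A second element of the cell of \<open>q\<close> forces the preimage of the
        first into a cell rather than a copy.\<close>
      obtain r where r: "r \<noteq> 0" "r \<in> cell (mark B q)" using other by blast
      then have "(q, None, r) \<in> keys B" using q by (simp add: keys_def)
      then obtain y where y: "y \<in> keys A" "(q, None, r) = F y"
        using order_iso_on_surj[OF F] by blast
      have "F x \<noteq> F y" unfolding x(2)[symmetric] y(2)[symmetric] using r by simp
      then have "x \<noteq> y" by blast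
      moreover have "cellmates (F x) (F y)"
        unfolding x(2)[symmetric] y(2)[symmetric] by (simp add: cellmates_def)
      ultimately have "cellmates x y"
        using order_iso_cellmates[OF F x(1) y(1)] by blast
      then obtain p t where "x = (p, None, t)" by (cases x) (auto simp: cellmates_def)
      then have "p \<in> points" "t \<in> cell (mark A p)" "x = (p, None, t)" using x by (auto simp: keys_def)
      then show ?thesis using Fr[of p t] x(2) by (metis prod.inject)
    qed
    then show "f ` points = points" using f_in by blast
  qed
  moreover have "mark B (f p) = mark A p" if p: "p \<in> points" for p
  proof -
    have "order_iso_on (\<lambda>r. snd (snd (F (p, None, r)))) (cell (mark A p)) (cell (mark B (f p)))"
    proof (rule order_iso_onI)
      fix r t assume rt: "r \<in> cell (mark A p)" "t \<in> cell (mark A p)" "r < t"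
      then have "F (p, None, r) < F (p, None, t)"
        using order_iso_on_less_iff[OF F, of "(p, None, r)" "(p, None, t)"] p by (simp add: keys_def)
      then have "(f p, None :: 'q option, snd (snd (F (p, None, r)))) < (f p, None, snd (snd (F (p, None, t))))"
        using Fr[OF p rt(1)] Fr[OF p rt(2)] by metis
      then show "snd (snd (F (p, None, r))) < snd (snd (F (p, None, t)))"
        by simp
    next
      have "snd (snd (F (p, None, r))) \<in> cell (mark B (f p))" if "r \<in> cell (mark A p)" for r
      proof -
        have "F (p, None, r) \<in> keys B"
          using order_iso_on_in[OF F] p that by (simp add: keys_def)
        then have "(f p, None, snd (snd (F (p, None, r)))) \<in> keys B"
          using Fr[OF p that] by metis
        then show ?thesis by (simp add: keys_def)
      qed
      moreover have "r' \<in> (\<lambda>r. snd (snd (F (p, None, r)))) ` cell (mark A p)" if "r' \<in> cell (mark B (f p))" for r'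
        using pre[OF p that] by force
      ultimately show "(\<lambda>r. snd (snd (F (p, None, r)))) ` cell (mark A p) = cell (mark B (f p))"
        by blast
    qed
    then show ?thesis
      using order_iso_on_cell mark_le by metis
  qed
  ultimately show ?thesis by blast
qed

end

text \<open>The rigidity of well-orders: at a least moved point \<open>x\<close>, a smaller value
  contradicts monotonicity, and a larger one leaves \<open>x\<close> outside the range. It will
  force blocks to be mapped identically.\<close>

lemma strict_mono_surj_wellorder:
  fixes k :: "'a::wellorder \<Rightarrow> 'a"
  assumes k: "strict_mono k" "surj k"
  shows "k x = x"
proof (induction x rule: less_induct)
  case (less x)
  show ?case
  proof (rule linorder_cases[of "k x" x])
    assume "k x < x"
    then have "k (k x) = k x" by (rule less)
    moreover have "k (k x) < k x" using \<open>k x < x\<close> k by (simp add: strict_monoD)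
    ultimately show ?thesis by simp
  next
    assume *: "x < k x"
    obtain y where y: "x = k y" using k by (metis surjD)
    show ?thesis
    proof (rule linorder_cases[of y x])
      assume "y < x"
      then show ?thesis using less[OF \<open>y < x\<close>] y by simp
    next
      assume "x < y"
      then have "k x < k y" using k by (simp add: strict_monoD)
      then show ?thesis using * y by simp
    qed (use y in simp)
  qed
qed

section \<open>Recovering the labelled tree\<close>

context structure_order
begin

lemma mark_eq_2_iff: "mark A p = 2 \<longleftrightarrow> snd p = None"
  by (simp add: mark_def split: option.split)

text \<open>Marks single out the start points, which gives \<open>g\<close>. The block of
  \<open>s\<close> is what lies between its start point and all later ones, so blocks go to blocks.
  As bits are ordered in type \<kappa>, rigidity matches them formula by formula.\<close>

lemma seqs_order_iso:
  assumes f: "order_iso_on f points points" and marks: "\<And>p. p \<in> points \<Longrightarrow> mark B (f p) = mark A p"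
  shows "\<exists>g. order_iso_on g seqs seqs \<and> (\<forall>s\<in>seqs. \<forall>i. atomic_type B (g s) i \<longleftrightarrow> atomic_type A s i)"
proof -
  have pt: "(s, j) \<in> points \<longleftrightarrow> s \<in> seqs" for s j by (simp add: points_def)
  have None_iff: "snd (f p) = None \<longleftrightarrow> snd p = None" if "p \<in> points" for p
    using marks[OF that] mark_eq_2_iff by metis
  define g where "g s = fst (f (s, None))" for s
  have fN: "f (s, None) = (g s, None)" if "s \<in> seqs" for s
    using None_iff[of "(s, None)"] that by (simp add: g_def pt prod_eq_iff)
  have g: "order_iso_on g seqs seqs"
  proof (rule order_iso_onI)
    fix s t assume st: "s \<in> seqs" "t \<in> seqs" "s < t"
    then have "f (s, None) < f (t, None)"
      using order_iso_on_less_iff[OF f] by (simp add: pt)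
    then show "g s < g t" using fN st by simp
  next
    have "g s \<in> seqs" if "s \<in> seqs" for s
      using order_iso_on_in[OF f, of "(s, None)"] fN[OF that] that by (simp add: pt)
    moreover have "\<exists>s\<in>seqs. t = g s" if t: "t \<in> seqs" for t
    proof -
      obtain p where p: "p \<in> points" "(t, None) = f p"
        using order_iso_on_surj[OF f, of "(t, None)"] t pt by blast
      then have "snd p = None" using None_iff[OF p(1)] by (metis snd_conv)
      then obtain s where "p = (s, None)" by (cases p) auto
      then show ?thesis using p fN[of s] pt by (metis prod.inject)
    qed
    ultimately show "g ` seqs = seqs" by blast
  qed
  have fS: "\<exists>j'. f (s, Some j) = (g s, Some j')" if s: "s \<in> seqs" for s j
  proof -
    obtain t j' where t: "f (s, Some j) = (t, Some j')"
      using None_iff[of "(s, Some j)"] s by (cases "f (s, Some j)") (auto simp: pt)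
    have ts: "t \<in> seqs" using order_iso_on_in[OF f, of "(s, Some j)"] s t by (simp add: pt)
    have "f (s, None) < f (s, Some j)"
      using order_iso_on_less_iff[OF f] s by (simp add: pt)
    then have "g s \<le> t" using fN[OF s] t by auto
    \<comment> \<open>Otherwise the start point of the preimage \<open>u\<close> of \<open>t\<close>
      would lie beyond the block of \<open>s\<close>, while its image lies below that of
      \<open>(s, Some j)\<close>.\<close>
    moreover have "\<not> g s < t"
    proof
      assume less: "g s < t"
      obtain u where u: "u \<in> seqs" "t = g u" using order_iso_on_surj[OF g ts] by blast
      have "s < u" using order_iso_on_less_iff[OF g s u(1)] less u by simp
      have "f (u, None) < f (s, Some j)" using fN[OF u(1)] t u by simp
      then have "(u, None) < (s, Some j)"
        using order_iso_on_less_iff[OF f, of "(u, None)" "(s, Some j)"] s u by (simp add: pt)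
      then show False using \<open>s < u\<close> by auto
    qed
    ultimately show ?thesis using t by auto
  qed
  have "f (s, Some j) = (g s, Some j)" if s: "s \<in> seqs" for s j
  proof -
    obtain k where k: "\<And>j. f (s, Some j) = (g s, Some (k j))" using fS[OF s] by metis
    have "strict_mono k"
    proof (rule strict_monoI)
      fix i j :: 'k assume "i < j"
      then have "f (s, Some i) < f (s, Some j)"
        using order_iso_on_less_iff[OF f] s by (simp add: pt)
      then show "k i < k j" by (simp add: k)
    qed
    moreover have "\<exists>i. j = k i" for j
    proof -
      have "(g s, Some j) \<in> points" using order_iso_on_in[OF g s] by (simp add: pt)
      then obtain p where p: "p \<in> points" "(g s, Some j) = f p" using order_iso_on_surj[OF f] by blast
      then have "snd p \<noteq> None" using None_iff[OF p(1)] by (metis option.distinct(1) snd_conv)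
      then obtain s' i where p': "p = (s', Some i)" by (cases p) auto
      then have s': "s' \<in> seqs" using p pt by blast
      then have "g s' = g s" using fS[OF s', of i] p p' by auto
      then have "s' = s" using order_iso_on_eq_iff[OF g s' s] by simp
      then show ?thesis using p p' k[of i] by auto
    qed
    then have "surj k" by (simp add: surj_def)
    ultimately show ?thesis using strict_mono_surj_wellorder k by metis
  qed
  then have "atomic_type B (g s) (idx j) \<longleftrightarrow> atomic_type A s (idx j)" if "s \<in> seqs" for s j
    using marks[of "(s, Some j)"] that by (simp add: pt mark_def split: if_splits)
  then have "atomic_type B (g s) i \<longleftrightarrow> atomic_type A s i" if "s \<in> seqs" for s i
    using that surj_idx by (metis surjD)
  then show ?thesis using g by blast
qed

text \<open>The formula equating position \<open>x\<close> with itself holds exactly when that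
  position exists; thus the length of a node can be read from its label.\<close>

lemma dom_eq_atomic_type: "dom (app s) = {x. atomic_type A s (0, [x, x])}"
  by (auto simp: atomic_type_def)

text \<open>The extensions of \<open>s\<close> form an interval beginning with \<open>s\<close>, so
  every later node up to an extension is longer than \<open>s\<close>. Conversely, if
  \<open>t\<close> leaves \<open>s\<close> at a position of \<open>s\<close>, a truncation of
  \<open>t\<close> lies above \<open>s\<close> without exceeding it in length.\<close>

lemma map_le_iff_less_eq:
  assumes s: "s \<in> seqs" and t: "t \<in> seqs"
  shows "app s \<subseteq>\<^sub>m app t \<longleftrightarrow> s \<le> t \<and> (\<forall>u\<in>seqs. s < u \<and> u \<le> t \<longrightarrow> \<not> dom (app u) \<subseteq> dom (app s))"
    (is "_ \<longleftrightarrow> ?R")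
proof
  assume le: "app s \<subseteq>\<^sub>m app t"
  have "s \<le> t"
  proof (rule ccontr)
    assume "\<not> s \<le> t"
    then have "t < s" by simp
    then obtain a where a: "app t a < app s a" by (auto simp: less_lexfun_def)
    then have "a \<in> dom (app s)" by (cases "app s a") auto
    then show False using le a by (simp add: map_le_def)
  qed
  moreover have False if u: "u \<in> seqs" "s < u" "u \<le> t" "dom (app u) \<subseteq> dom (app s)" for u
  proof -
    obtain a where a: "\<And>b. b < a \<Longrightarrow> app s b = app u b" "app s a < app u a"
      using u(2) unfolding less_lexfun_def by blast
    then have "a \<in> dom (app u)" by (cases "app u a") auto
    then have as: "a \<in> dom (app s)" using u by blast
    have ts: "app t b = app s b" if "b \<le> a" for b
    proof -
      obtain c where "dom (app s) = {..<c}" using s by (auto simp: seqs_def)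
      then have "b \<in> dom (app s)" using as that by auto
      then show ?thesis using le by (simp add: map_le_def)
    qed
    have "t < u" by (rule less_lexfunI[of a]) (use a ts in auto)
    then show False using u by simp
  qed
  ultimately show ?R by blast
next
  assume R: ?R
  show "app s \<subseteq>\<^sub>m app t"
  proof (cases "s = t")
    case False
    moreover have "s \<le> t" using R by blast
    ultimately have "s < t" by simp
    then obtain a where a: "\<And>b. b < a \<Longrightarrow> app s b = app t b" "app s a < app t a"
      unfolding less_lexfun_def by blast
    obtain c where c: "dom (app s) = {..<c}" using s by (auto simp: seqs_def)
    have "a \<notin> dom (app s)"
    proof
      assume as: "a \<in> dom (app s)"
      \<comment> \<open>This is \<open>t\<close> cut just after the first difference; its length is
        at most that of \<open>s\<close>, since \<open>a\<close> is a position of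
        \<open>s\<close>.\<close>
      define u where "u = Lex (\<lambda>x. if x \<le> a then app t x else None)"
      obtain d where d: "dom (app t) = {..<d}" using t by (auto simp: seqs_def)
      have "a \<in> dom (app t)" using a by (cases "app t a") auto
      then have ad: "a < d" using d by simp
      have "dom (app u) = {..a}" 
      proof -
        have "dom (app u) = {..a} \<inter> dom (app t)" by (auto simp: u_def dom_def)
        then show ?thesis using d ad by auto
      qed
      then have "u \<in> seqs" "dom (app u) \<subseteq> dom (app s)"
        using atMost_eq_lessThan[of a] as c by (auto simp: seqs_def)
      moreover have "s < u" by (rule less_lexfunI[of a]) (use a in \<open>auto simp: u_def\<close>)
      moreover have "u \<le> t"
      proof (rule ccontr)
        assume "\<not> u \<le> t"
        then have "t < u" by simp
        then obtain x where x: "app t x < app u x" by (auto simp: less_lexfun_def)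
        then show False by (auto simp: u_def split: if_splits)
      qed
      ultimately show False using R by blast
    qed
    then have "b < a" if "b \<in> dom (app s)" for b using that c by (auto simp: not_less)
    then show ?thesis using a by (simp add: map_le_def)
  qed simp
qed

section \<open>Exhausting branches and the isomorphism they determine\<close>

definition initial :: "('k \<Rightarrow> 'q) \<Rightarrow> 'k \<Rightarrow> ('k, 'q option) lexfun" where
  "initial f a = Lex (\<lambda>x. if x < a then Some (f x) else None)"

lemma dom_initial: "dom (app (initial f a)) = {..<a}"
  by (auto simp: initial_def dom_def)

lemma initial_seqs: "initial f a \<in> seqs"
  using dom_initial by (auto simp: seqs_def)

lemma initial_mono: "a \<le> b \<Longrightarrow> app (initial f a) \<subseteq>\<^sub>m app (initial f b)"
  by (auto simp: map_le_def initial_def dom_def)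

text \<open>Every element of either structure is met along the branch \<open>f\<close>, whose image under \<open>g\<close> is the
  branch \<open>f'\<close>; limit stages are unproblematic as \<open>g\<close> preserves the initial segment relation.\<close>

lemma ex_branches:
  assumes g: "order_iso_on g seqs seqs"
    and atomic: "\<And>s i. s \<in> seqs \<Longrightarrow> atomic_type B (g s) i \<longleftrightarrow> atomic_type A s i"
  shows "\<exists>f f'. (\<forall>a. g (initial f a) = initial f' a) \<and> surj (col \<circ> f) \<and> surj (col \<circ> f')"
proof -
  have dom_g: "dom (app (g s)) = dom (app s)" if "s \<in> seqs" for s
    using dom_eq_atomic_type[of s A] dom_eq_atomic_type[of "g s" B] atomic[OF that] by simp
  have g_in: "g s \<in> seqs" if "s \<in> seqs" for s
    using order_iso_on_in[OF g that] .
  \<comment> \<open>Initial segments are expressible through the order and the lengths, both of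
    which \<open>g\<close> respects.\<close>
  have g_le: "app (g s) \<subseteq>\<^sub>m app (g t) \<longleftrightarrow> app s \<subseteq>\<^sub>m app t" if st: "s \<in> seqs" "t \<in> seqs" for s t
  proof -
    have "(\<forall>u\<in>seqs. g s < u \<and> u \<le> g t \<longrightarrow> \<not> dom (app u) \<subseteq> dom (app (g s)))
        \<longleftrightarrow> (\<forall>u\<in>seqs. g s < g u \<and> g u \<le> g t \<longrightarrow> \<not> dom (app (g u)) \<subseteq> dom (app (g s)))"
      using order_iso_on_image[OF g] by (metis (no_types, lifting) imageE imageI)
    also have "\<dots> \<longleftrightarrow> (\<forall>u\<in>seqs. s < u \<and> u \<le> t \<longrightarrow> \<not> dom (app u) \<subseteq> dom (app s))"
      using order_iso_on_less_iff[OF g] order_iso_on_le_iff[OF g] dom_g st by auto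
    finally show ?thesis
      unfolding map_le_iff_less_eq[OF st] map_le_iff_less_eq[OF g_in g_in, OF st]
      using order_iso_on_le_iff[OF g st] by simp
  qed
  obtain suc :: "'k \<Rightarrow> 'k" where suc: "\<And>a. {..a} = {..<suc a}" using atMost_eq_lessThan by metis
  have less_suc: "x < suc a \<longleftrightarrow> x \<le> a" for x a
    using suc by (metis atMost_iff lessThan_iff)
  obtain task :: "'k \<Rightarrow> 'k + 'k" where task: "surj task" using surj_sum by blast
  \<comment> \<open>The value of the image branch at position \<open>a\<close> depends on
    \<open>f\<close> up to and including \<open>a\<close>, hence \<open>suc a\<close>.\<close>
  define tip where "tip f a = the (app (g (initial f (suc a))) a)" for f a
  define good where "good f a q \<longleftrightarrow>
      (case task a of Inl k \<Rightarrow> col q = k | Inr k \<Rightarrow> col (tip (f(a := q)) a) = k)" for f :: "'k \<Rightarrow> 'q" and a q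
  have "\<exists>f. \<forall>a. good f a (f a)"
  proof (rule dependent_wf_choice[OF wf])
    fix f f' :: "'k \<Rightarrow> 'q" and a q
    assume *: "\<And>z. (z, a) \<in> {(y, x). y < x} \<Longrightarrow> f z = f' z"
    have "initial (f(a := q)) (suc a) = initial (f'(a := q)) (suc a)"
      unfolding initial_def by (rule arg_cong[of _ _ Lex]) (use * in \<open>auto simp: fun_eq_iff less_suc\<close>)
    then show "good f a q = good f' a q" by (simp add: good_def tip_def split: sum.split)
  next
    fix a and f :: "'k \<Rightarrow> 'q"
    show "\<exists>q. good f a q"
    proof (cases "task a")
      case (Inl k)
      then show ?thesis using ex_col by (auto simp: good_def)
    next
      case (Inr k)
      obtain y where y: "col y = k" using ex_col by blast
      \<comment> \<open>To make the image branch meet \<open>k\<close>, its current part is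
        prolonged by an element of colour \<open>k\<close> and pulled back. The preimage prolongs
        \<open>initial f a\<close> by one position, and its last value is the required
        choice.\<close>
      define t where "t = g (initial f a)"
      define t' where "t' = Lex ((app t)(a \<mapsto> y))"
      have dt: "dom (app t) = {..<a}" using dom_g[OF initial_seqs] dom_initial by (simp add: t_def)
      then have dt': "dom (app t') = {..<suc a}" by (auto simp: t'_def less_suc)
      then have "t' \<in> seqs" by (auto simp: seqs_def)
      then obtain s where s: "s \<in> seqs" "t' = g s" using order_iso_on_surj[OF g] by blast
      have ds: "dom (app s) = {..<suc a}" using dom_g[OF s(1)] s dt' by simp
      have "app t \<subseteq>\<^sub>m app t'" using dt by (auto simp: t'_def map_le_def)
      then have le: "app (initial f a) \<subseteq>\<^sub>m app s"
        using g_le[OF initial_seqs s(1)] by (simp add: t_def s)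
      have "initial (f(a := the (app s a))) (suc a) = s"
      proof (rule lexfun_eqI)
        fix x
        consider "x < a" | "x = a" | "a < x" by (rule linorder_cases)
        then show "app (initial (f(a := the (app s a))) (suc a)) x = app s x"
        proof cases
          case 1
          then have "app (initial f a) x = app s x"
            using le by (simp add: map_le_def dom_initial)
          then show ?thesis using 1 by (simp add: initial_def less_suc less_imp_le)
        next
          case 2
          have "a \<in> dom (app s)" using ds by (simp add: less_suc)
          then show ?thesis using 2 by (auto simp: initial_def less_suc)
        next
          case 3
          then have "x \<notin> dom (app s)" using ds by (simp add: less_suc)
          then show ?thesis using 3 by (auto simp: initial_def less_suc)
        qed
      qed
      then have "tip (f(a := the (app s a))) a = y"
        by (simp add: tip_def s(2)[symmetric] t'_def)
      then show ?thesis using Inr y by (auto simp: good_def)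
    qed
  qed
  then obtain f where f: "\<And>a. good f a (f a)" by blast
  have "g (initial f a) = initial (tip f) a" for a
  proof (rule lexfun_eqI)
    fix x
    have d: "dom (app (g (initial f b))) = {..<b}" for b
      using dom_g[OF initial_seqs] dom_initial by simp
    show "app (g (initial f a)) x = app (initial (tip f) a) x"
    proof (cases "x < a")
      case True
      then have "suc x \<le> a" using less_suc by (metis leI not_le)
      then have le: "app (g (initial f (suc x))) \<subseteq>\<^sub>m app (g (initial f a))"
        using g_le[OF initial_seqs initial_seqs] initial_mono by blast
      have x: "x \<in> dom (app (g (initial f (suc x))))" by (simp add: d less_suc)
      then have "app (g (initial f a)) x = app (g (initial f (suc x))) x"
        using le by (simp add: map_le_def)
      also have "\<dots> = Some (tip f x)" using x by (auto simp: tip_def)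
      finally show ?thesis using True by (simp add: initial_def)
    next
      case False
      then have "x \<notin> dom (app (g (initial f a)))" by (simp add: d)
      then show ?thesis using False by (auto simp: initial_def)
    qed
  qed
  moreover have "surj (col \<circ> f)"
  proof (rule surjI)
    fix k
    have "task (inv task (Inl k)) = Inl k" using task by (rule surj_f_inv_f)
    then show "(col \<circ> f) (inv task (Inl k)) = k" using f[of "inv task (Inl k)"] by (simp add: good_def)
  qed
  moreover have "surj (col \<circ> tip f)"
  proof (rule surjI)
    fix k
    have "task (inv task (Inr k)) = Inr k" using task by (rule surj_f_inv_f)
    then show "(col \<circ> tip f) (inv task (Inr k)) = k" using f[of "inv task (Inr k)"] by (simp add: good_def)
  qed
  ultimately show ?thesis by blast
qed

lemma atomic_type_initial:
  assumes "set js \<subseteq> {..<a}"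
  shows "atomic_type A (initial f a) (Suc n, js) \<longleftrightarrow> (n, map (col \<circ> f) js) \<in> A"
    and "js = [x, y] \<Longrightarrow> atomic_type A (initial f a) (0, js) \<longleftrightarrow> col (f x) = col (f y)"
proof -
  have c: "colour_at (initial f a) x = col (f x)" if "x \<in> set js" for x
  proof -
    have "x < a" using assms that by auto
    then show ?thesis by (simp add: colour_at_def initial_def)
  qed
  then have m: "map (colour_at (initial f a)) js = map (col \<circ> f) js" by simp
  show "atomic_type A (initial f a) (Suc n, js) \<longleftrightarrow> (n, map (col \<circ> f) js) \<in> A"
    using assms by (simp add: atomic_type_def dom_initial m del: map_eq_conv)
  show "js = [x, y] \<Longrightarrow> atomic_type A (initial f a) (0, js) \<longleftrightarrow> col (f x) = col (f y)"
    using assms c by (simp add: atomic_type_def dom_initial)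
qed

text \<open>Branches matched by \<open>g\<close> satisfy the same atomic formulas at the same
  positions. Equality formulas make the correspondence of their colours well defined and injective,
  the other formulas make it respect the relations, and as both branches meet every colour it is a
  bijection of \<kappa>.\<close>

lemma isomorphic_if_order_iso:
  assumes "order_iso_on F (keys A) (keys B)"
  shows "isomorphic V A B"
proof -
  obtain p where p: "order_iso_on p points points" "\<And>x. x \<in> points \<Longrightarrow> mark B (p x) = mark A x"
    using points_order_iso[OF assms] by blast
  obtain g where g: "order_iso_on g seqs seqs" "\<And>s i. s \<in> seqs \<Longrightarrow> atomic_type B (g s) i \<longleftrightarrow> atomic_type A s i"
    using seqs_order_iso[OF p] by blast
  obtain f f' where ff': "\<And>a. g (initial f a) = initial f' a" and sur: "surj (col \<circ> f)" "surj (col \<circ> f')"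
    using ex_branches[OF g] by blast
  \<comment> \<open>Finitely many positions fit into one proper initial segment, so the labels of
    nodes suffice to compare whole branches.\<close>
  have bound: "\<exists>a. set js \<subseteq> {..<a}" for js :: "'k list"
  proof -
    obtain b where b: "Max (insert kzero (set js)) < b" using ex_greater by blast
    then have "set js \<subseteq> {..<b}" by auto
    then show ?thesis by blast
  qed
  have atomic: "atomic_type B (initial f' a) i \<longleftrightarrow> atomic_type A (initial f a) i" for a i
    using g(2)[OF initial_seqs[of f a]] ff' by simp
  have rel: "(n, map (col \<circ> f) js) \<in> A \<longleftrightarrow> (n, map (col \<circ> f') js) \<in> B" for n js
    using bound[of js] atomic atomic_type_initial(1) by metis
  have eq: "col (f x) = col (f y) \<longleftrightarrow> col (f' x) = col (f' y)" for x y
    using bound[of "[x, y]"] atomic atomic_type_initial(2)[of "[x, y]" _ x y] by metis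
  define i where "i = inv (col \<circ> f)"
  have i: "col (f (i k)) = k" for k
    using surj_f_inv_f[OF sur(1), of k] by (simp add: i_def)
  define h where "h k = col (f' (i k))" for k
  have h: "h (col (f x)) = col (f' x)" for x
    using eq[of "i (col (f x))" x] i by (simp add: h_def)
  have "inj h"
    using eq i by (metis h_def injI)
  moreover have "\<exists>k. y = h k" for y
  proof -
    obtain x where "y = col (f' x)" using sur(2) by (metis comp_apply surjD)
    then show ?thesis using h by metis
  qed
  then have "surj h" by (simp add: surj_def)
  moreover have "(n, xs) \<in> A \<longleftrightarrow> (n, map h xs) \<in> B" for n xs
  proof -
    have "map (col \<circ> f) (map i xs) = xs" by (simp add: comp_def i)
    moreover have "map (col \<circ> f') (map i xs) = map h xs" by (simp add: h_def)
    ultimately show ?thesis using rel[of n "map i xs"] by metis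
  qed
  ultimately show ?thesis
    unfolding isomorphic_def bij_def by blast
qed

text \<open>The lift \<open>H\<close> acts entrywise on sequences and changes their colours by
  \<open>h\<close>, so a sequence has the same label in \<open>A\<close> as its image in
  \<open>B\<close>. The rest of a key is left alone.\<close>

lemma order_iso_if_isomorphic:
  assumes A: "A \<in> structures V" and B: "B \<in> structures V" and iso: "isomorphic V A B"
  shows "\<exists>F. order_iso_on F (keys A) (keys B)"
proof -
  obtain h where h: "bij h" "\<forall>(n, xs)\<in>atoms V. (n, xs) \<in> A \<longleftrightarrow> (n, map h xs) \<in> B"
    using iso by (auto simp: isomorphic_def)
  \<comment> \<open>Labels contain formulas of every index and every length; those outside the
    vocabulary fail in both structures.\<close>
  have rel: "(n, map h xs) \<in> B \<longleftrightarrow> (n, xs) \<in> A" for n xs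
  proof (cases "(n, xs) \<in> atoms V")
    case False
    then have "(n, map h xs) \<notin> atoms V" by (simp add: atoms_def)
    then show ?thesis using False A B by (auto simp: structures_def)
  qed (use h in auto)
  obtain H where H: "bij H" "strict_mono H" "\<And>x. col (H x) = h (col x)"
    using lift_permutation[OF h(1)] by blast
  define M where "M s = Lex (\<lambda>x. map_option H (app s x))" for s :: "('k, 'q option) lexfun"
  have dom_M: "dom (app (M s)) = dom (app s)" for s
    by (auto simp: M_def dom_def)
  have M_seqs: "M s \<in> seqs \<longleftrightarrow> s \<in> seqs" for s
    by (simp add: seqs_def dom_M)
  have M_less: "M s < M t" if st: "s < t" for s t
  proof -
    obtain a where a: "\<And>b. b < a \<Longrightarrow> app s b = app t b" "app s a < app t a"
      using st unfolding less_lexfun_def by blast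
    have "map_option H (app s a) < map_option H (app t a)"
      using a(2) H(2) by (cases "app s a"; cases "app t a") (auto simp: strict_monoD)
    then show ?thesis
      by (intro less_lexfunI[of a]) (use a in \<open>auto simp: M_def\<close>)
  qed
  have M_surj: "\<exists>s. t = M s" for t
  proof
    show "t = M (Lex (\<lambda>x. map_option (inv H) (app t x)))"
      using H(1) by (intro lexfun_eqI) (simp add: M_def option.map_comp comp_def surj_f_inv_f bij_is_surj option.map_ident)
  qed
  have colour: "colour_at (M s) x = h (colour_at s x)" if "x \<in> dom (app s)" for s x
    using that H(3) by (auto simp: colour_at_def M_def)
  have atomic: "atomic_type B (M s) i \<longleftrightarrow> atomic_type A s i" for s i
  proof (cases "set (snd i) \<subseteq> dom (app s)")
    case True
    then have m: "map (colour_at (M s)) (snd i) = map h (map (colour_at s) (snd i))"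
      using colour by auto
    have eq: "colour_at (M s) x = colour_at (M s) y \<longleftrightarrow> colour_at s x = colour_at s y" if "snd i = [x, y]" for x y
      using that True colour h(1) by (auto simp: bij_is_inj inj_eq)
    show ?thesis
      unfolding atomic_type_def m dom_M rel by (auto split: nat.split simp: eq)
  qed (simp add: atomic_type_def dom_M)
  have mark: "mark B (M s, j) = mark A (s, j)" for s j
    by (simp add: mark_def atomic split: option.split)
  define F :: "('k, 'q) key \<Rightarrow> ('k, 'q) key" where "F = map_prod (map_prod M id) id"
  have F: "F ((s, j), d) = ((M s, j), d)" for s j d by (simp add: F_def)
  have keys: "F ((s, j), e, r) \<in> keys B \<longleftrightarrow> ((s, j), e, r) \<in> keys A" for s j e r
    by (simp add: F keys_def points_def M_seqs mark)
  have "order_iso_on F (keys A) (keys B)"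
  proof (rule order_iso_onI)
    fix x y :: "('k, 'q) key"
    assume "x < y"
    obtain s j d t k e where xy: "x = ((s, j), d)" "y = ((t, k), e)" by (metis prod.exhaust)
    have "s < t \<or> s = t \<and> (j, d) < (k, e)"
      using \<open>x < y\<close> by (auto simp: xy order_le_less)
    then show "F x < F y"
      using M_less by (auto simp: xy F)
  next
    show "F ` keys A = keys B"
    proof
      show "F ` keys A \<subseteq> keys B" using keys by force
      show "keys B \<subseteq> F ` keys A"
      proof
        fix y assume y: "y \<in> keys B"
        obtain t j e r where t: "y = ((t, j), e, r)" by (metis prod.exhaust)
        obtain s where "t = M s" using M_surj by blast
        then have "y = F ((s, j), e, r)" by (simp add: t F)
        then show "y \<in> F ` keys A" using y keys by blast
      qed
    qed
  qed
  then show ?thesis by blast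
qed

end

section \<open>Borel sets\<close>

lemma openin_baire_cone: "p \<in> kseqs \<Longrightarrow> openin baire (cone_of p)"
  unfolding baire_def by (rule topology_generated_by_Basis) blast

lemma topspace_baire [simp]: "topspace baire = (UNIV :: ('k::wellorder \<Rightarrow> 'k) set)"
proof -
  have "cone_of Map.empty = (UNIV :: ('k \<Rightarrow> 'k) set)" by (simp add: cone_of_def)
  moreover have "(Map.empty :: 'k \<rightharpoonup> 'k) \<in> kseqs"
    by (auto simp: kseqs_def kzero_def intro!: exI[of _ "LEAST x. True"] dest: not_less_Least)
  ultimately show ?thesis
    using openin_baire_cone[of "Map.empty :: 'k \<rightharpoonup> 'k"] openin_subset by fastforce
qed

lemma kborel_open: "openin baire U \<Longrightarrow> U \<in> kborel"
proof -
  assume "openin baire U"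
  then have "- U \<in> kborel"
    by (intro kborel.closed) (simp add: closedin_def)
  then show "U \<in> kborel" using kborel.compl[of "- U"] by simp
qed

lemma kborel_Un: "A \<in> kborel \<Longrightarrow> B \<in> kborel \<Longrightarrow> A \<union> B \<in> kborel"
  and kborel_Int: "A \<in> kborel \<Longrightarrow> B \<in> kborel \<Longrightarrow> A \<inter> B \<in> kborel"
  if "c \<noteq> d" for A B :: "('k::wellorder \<Rightarrow> 'k) set" and c d :: 'k
proof -
  assume AB: "A \<in> kborel" "B \<in> kborel"
  have "(\<Union>i :: 'k. if i = c then A else B) \<in> kborel" "(\<Inter>i :: 'k. if i = c then A else B) \<in> kborel"
    by (rule kborel.union kborel.inter; simp add: AB)+
  moreover have "(\<Union>i :: 'k. if i = c then A else B) = A \<union> B" "(\<Inter>i :: 'k. if i = c then A else B) = A \<inter> B"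
    using that by (auto split: if_splits)
  ultimately show "A \<union> B \<in> kborel" "A \<inter> B \<in> kborel" by simp_all
qed

context kappa_exp
begin

lemma openin_baire_if_initial:
  assumes "\<And>\<eta>. \<eta> \<in> U \<Longrightarrow> \<exists>a. \<forall>\<xi> :: 'k \<Rightarrow> 'k. (\<forall>x<a. \<xi> x = \<eta> x) \<longrightarrow> \<xi> \<in> U"
  shows "openin baire U"
proof (subst openin_subopen, intro ballI)
  fix \<eta> assume "\<eta> \<in> U"
  then obtain a where a: "\<forall>\<xi>. (\<forall>x<a. \<xi> x = \<eta> x) \<longrightarrow> \<xi> \<in> U" using assms by blast
  define p where "p = (\<lambda>x. if x < a then Some (\<eta> x) else None)"
  have dom: "dom p = {..<a}" by (auto simp: p_def dom_def)
  have "openin baire (cone_of p)" by (rule openin_baire_cone) (auto simp: kseqs_def dom)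
  moreover have "\<eta> \<in> cone_of p" by (auto simp: cone_of_def map_le_def p_def split: if_splits)
  moreover have "cone_of p \<subseteq> U"
  proof
    fix \<xi> assume "\<xi> \<in> cone_of p"
    then have "\<forall>x<a. p x = Some (\<xi> x)" by (simp add: cone_of_def map_le_def dom)
    then have "\<forall>x<a. \<xi> x = \<eta> x" by (simp add: p_def)
    then show "\<xi> \<in> U" using a by blast
  qed
  ultimately show "\<exists>T. openin baire T \<and> \<eta> \<in> T \<and> T \<subseteq> U" by blast
qed

lemma kborel_coordinate: "{\<eta> :: 'k \<Rightarrow> 'k. P (\<eta> x)} \<in> kborel"
proof (rule kborel_open, rule openin_baire_if_initial)
  fix \<eta> :: "'k \<Rightarrow> 'k" assume \<eta>: "\<eta> \<in> {\<eta>. P (\<eta> x)}"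
  obtain a where "x < a" using ex_greater by blast
  then show "\<exists>a. \<forall>\<xi>. (\<forall>x<a. \<xi> x = \<eta> x) \<longrightarrow> \<xi> \<in> {\<eta>. P (\<eta> x)}" using \<eta> by (auto intro!: exI[of _ a])
qed

lemma kzero_less_kone: "(kzero :: 'k) < kone"
  unfolding kone_def by (rule LeastI_ex[OF ex_greater])

lemmas kborel_binary = kborel_Un[OF less_imp_neq[OF kzero_less_kone]] kborel_Int[OF less_imp_neq[OF kzero_less_kone]]

lemma kborel_const: "{\<eta> :: 'k \<Rightarrow> 'k. P} \<in> kborel"
  using kborel_coordinate[of "\<lambda>_. P"] by simp

text \<open>Quantifiers range over \<kappa>, so they become unions and intersections of length
  \<kappa>; an atomic formula reads a single coordinate.\<close>

lemma kborel_sat: "{\<eta> :: 'k \<Rightarrow> 'k. sat (struct_of V \<pi> \<eta>) v p} \<in> kborel"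
proof (induction p arbitrary: v)
  case (Eq x y)
  show ?case using kborel_const by simp
next
  case (Rel n xs)
  show ?case
    using kborel_coordinate[of "\<lambda>z. (n, map v xs) \<in> atoms V \<and> z = kone" "\<pi> (n, map v xs)"]
    by (simp add: struct_of_def)
next
  case (Neg p)
  then show ?case using kborel.compl[OF Neg[of v]] by (simp add: Collect_neg_eq)
next
  case (Conj p q)
  then show ?case using kborel_binary(2)[OF Conj] by (simp add: Collect_conj_eq)
next
  case (Disj p q)
  then show ?case using kborel_binary(1)[OF Disj] by (simp add: Collect_disj_eq)
next
  case (Imp p q)
  then show ?case using kborel_binary(1)[OF kborel.compl[OF Imp(1)] Imp(2)] by (simp add: Collect_imp_eq)
next
  case (All x p)
  then show ?case using kborel.inter[of "\<lambda>a. {\<eta>. sat (struct_of V \<pi> \<eta>) (v(x := a)) p}"]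
    by (simp add: Collect_all_eq)
next
  case (Ex x p)
  then show ?case using kborel.union[of "\<lambda>a. {\<eta>. sat (struct_of V \<pi> \<eta>) (v(x := a)) p}"]
    by (simp add: Collect_ex_eq)
qed

lemma kborel_cantor: "(cantor :: ('k \<Rightarrow> 'k) set) \<in> kborel"
proof -
  have "(cantor :: ('k \<Rightarrow> 'k) set) = (\<Inter>x. {\<eta>. \<eta> x \<in> {kzero, kone}})"
    by (auto simp: cantor_def)
  moreover have "(\<Inter>x. {\<eta> :: 'k \<Rightarrow> 'k. \<eta> x \<in> {kzero, kone}}) \<in> kborel"
    by (rule kborel.inter, rule kborel_coordinate)
  ultimately show ?thesis by (simp only:)
qed

text \<open>Membership of a value in a basic set of length \<open>a\<close> depends on the
  coordinates \<open>r x\<close> for \<open>x < a\<close>, which are bounded by regularity. Hence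
  such a map is even continuous.\<close>

lemma borel_map_on_if_coordinatewise:
  fixes f :: "('k \<Rightarrow> 'k) \<Rightarrow> 'k \<Rightarrow> 'k"
  assumes "\<And>x. \<exists>y. \<forall>\<eta> \<xi>. \<eta> y = \<xi> y \<longrightarrow> f \<eta> x = f \<xi> x"
  shows "borel_map_on Y f"
proof -
  obtain r where r: "\<And>x \<eta> \<xi>. \<eta> (r x) = \<xi> (r x) \<Longrightarrow> f \<eta> x = f \<xi> x"
    using assms by metis
  have "continuous_map baire baire f"
    unfolding baire_def[symmetric] 
  proof (subst (2) baire_def, rule continuous_on_generated_topo)
    fix U :: "('k \<Rightarrow> 'k) set" assume "U \<in> cone_of ` kseqs"
    then obtain p a where p: "U = cone_of p" "dom p = {..<a}" by (auto simp: kseqs_def)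
    obtain b where b: "\<forall>x<a. r x < b" using bounded_image by blast
    have "openin baire (f -` U)"
    proof (rule openin_baire_if_initial)
      fix \<eta> assume \<eta>: "\<eta> \<in> f -` U"
      have "\<xi> \<in> f -` U" if "\<forall>x<b. \<xi> x = \<eta> x" for \<xi>
      proof -
        have "f \<xi> x = f \<eta> x" if "x < a" for x
          using r[of \<xi> x \<eta>] b that \<open>\<forall>x<b. \<xi> x = \<eta> x\<close> by blast
        then show ?thesis using \<eta> p by (simp add: cone_of_def map_le_def)
      qed
      then show "\<exists>b. \<forall>\<xi>. (\<forall>x<b. \<xi> x = \<eta> x) \<longrightarrow> \<xi> \<in> f -` U" by blast
    qed
    then show "openin baire (f -` U \<inter> topspace baire)" by simp
  next
    have "\<Union> (cone_of ` kseqs) = topspace (baire :: ('k \<Rightarrow> 'k) topology)"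
      unfolding baire_def by (rule topology_generated_by_topspace[symmetric])
    then show "f ` topspace baire \<subseteq> \<Union> (cone_of ` kseqs)" by simp
  qed
  then have "openin baire (f -` U)" if "openin baire U" for U
    using openin_continuous_map_preimage[OF _ that, of baire f] by (simp add: vimage_def)
  then show ?thesis
    unfolding borel_map_on_def
  proof (intro allI impI)
    fix U :: "('k \<Rightarrow> 'k) set" assume "openin baire U"
    then have "f -` U \<in> kborel" using kborel_open \<open>\<And>U. openin baire U \<Longrightarrow> openin baire (f -` U)\<close> by blast
    moreover have "{\<eta> \<in> Y. f \<eta> \<in> U} = f -` U \<inter> Y" by auto
    ultimately show "\<exists>B\<in>kborel. {\<eta> \<in> Y. f \<eta> \<in> U} = B \<inter> Y" by blast
  qed
qed

end

section \<open>Dense linear orders\<close>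

text \<open>The axioms are sentences, so a single assignment suffices, and being a model becomes a
  finite intersection of conditions covered by \<open>kborel_sat\<close>.\<close>

lemma models_DLO_iff:
  "models A DLO \<longleftrightarrow> (\<forall>p\<in>DLO. sat A v p)"
  by (auto simp: models_def DLO_def)

lemma models_DLO:
  "models A DLO \<longleftrightarrow>
    (\<forall>x. (0, [x, x]) \<notin> A) \<and>
    (\<forall>x y z. (0, [x, y]) \<in> A \<longrightarrow> (0, [y, z]) \<in> A \<longrightarrow> (0, [x, z]) \<in> A) \<and>
    (\<forall>x y. (0, [x, y]) \<in> A \<or> x = y \<or> (0, [y, x]) \<in> A) \<and>
    (\<forall>x y. (0, [x, y]) \<in> A \<longrightarrow> (\<exists>z. (0, [x, z]) \<in> A \<and> (0, [z, y]) \<in> A)) \<and>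
    (\<forall>x. \<exists>y. (0, [x, y]) \<in> A) \<and> (\<forall>x. \<exists>y. (0, [y, x]) \<in> A)"
  by (auto simp: models_def DLO_def)

lemma atoms_order_vocabulary: "atoms order_vocabulary = {(0, [x, y]) | x y. True}"
  by (auto simp: atoms_def order_vocabulary_def numeral_2_eq_2 Suc_length_conv length_Suc_conv split: if_splits)

lemma isomorphic_order_vocabulary:
  "isomorphic order_vocabulary A B \<longleftrightarrow>
     (\<exists>h. bij h \<and> (\<forall>x y. (0, [x, y]) \<in> A \<longleftrightarrow> (0, [h x, h y]) \<in> B))"
  unfolding isomorphic_def atoms_order_vocabulary by fastforce

lemma iso_closed_DLO: "iso_closed order_vocabulary {A \<in> structures order_vocabulary. models A DLO}"
proof -
  have "models B DLO" if A: "models A DLO" and AB: "isomorphic order_vocabulary A B" for A B :: "'a struct"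
  proof -
    obtain h where h: "bij h" "\<And>x y. (0, [x, y]) \<in> A \<longleftrightarrow> (0, [h x, h y]) \<in> B"
      using AB unfolding isomorphic_order_vocabulary by blast
    define g where "g = inv h"
    have g: "h (g x) = x" "g (h x) = x" for x
      using h(1) by (simp_all add: g_def bij_is_surj surj_f_inv_f bij_is_inj)
    have B: "(0, [x, y]) \<in> B \<longleftrightarrow> (0, [g x, g y]) \<in> A" for x y
      by (simp add: h(2) g)
    show ?thesis
      using A unfolding models_DLO B by (elim conjE, intro conjI) (metis g)+
  qed
  then show ?thesis by (auto simp: iso_closed_def)
qed

context kappa_exp
begin

lemma kborel_codes_DLO:
  "(codes order_vocabulary \<pi> {A \<in> structures order_vocabulary. models A DLO} :: ('k \<Rightarrow> 'k) set) \<in> kborel"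
proof -
  define S where "S p = {\<eta> :: 'k \<Rightarrow> 'k. sat (struct_of order_vocabulary \<pi> \<eta>) (\<lambda>_. kzero) p}" for p
  have struct: "struct_of order_vocabulary \<pi> \<eta> \<in> structures order_vocabulary" for \<eta> :: "'k \<Rightarrow> 'k"
    by (auto simp: struct_of_def structures_def)
  have "codes order_vocabulary \<pi> {A \<in> structures order_vocabulary. models A DLO} = cantor \<inter> (\<Inter>p\<in>DLO. S p)"
    using struct by (auto simp: codes_def S_def models_DLO_iff[of _ "\<lambda>_. kzero"])
  moreover have "(\<Inter>p\<in>F. S p) \<in> kborel" if "finite F" for F
    using that
  proof induction
    case empty
    show ?case using kborel_const[of True] by simp
  next
    case (insert p F)
    then show ?case using kborel_binary(2) kborel_sat by (simp add: S_def)
  qed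
  moreover have "finite DLO" by (simp add: DLO_def)
  ultimately show ?thesis using kborel_binary(2) kborel_cantor by simp
qed

lemma ISO_DLO_in_S_class:
  assumes "coding order_vocabulary (\<pi> :: nat \<times> 'k list \<Rightarrow> 'k)"
  shows "ISO_theory order_vocabulary \<pi> DLO \<in> S_class"
  using assms iso_closed_DLO kborel_codes_DLO unfolding S_class_def ISO_theory_def by blast

end

section \<open>The reduction\<close>

text \<open>Cells are matched with the rationals as bare sets, without regard to order. The elements
  of all the orders can thus be indexed by one set, on which only the ordering varies with the
  structure.\<close>

definition cell_bij :: "nat \<Rightarrow> rat \<Rightarrow> rat" where
  "cell_bij m = from_nat_into (cell m) \<circ> to_nat_on UNIV"

lemma bij_betw_cell_bij: "bij_betw (cell_bij m) UNIV (cell m)"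
proof -
  have "infinite (cell m)"
    by (simp add: cell_def infinite_Ici infinite_Iic infinite_UNIV_char_0)
  then have "bij_betw (from_nat_into (cell m)) UNIV (cell m)"
    by (intro bij_betw_from_nat_into) auto
  moreover have "bij_betw (to_nat_on (UNIV :: rat set)) UNIV UNIV"
    by (intro to_nat_on_infinite) (auto simp: infinite_UNIV_char_0)
  ultimately show ?thesis
    unfolding cell_bij_def by (rule bij_betw_trans[rotated])
qed

context structure_order
begin

text \<open>By Schroeder-Bernstein. The injection into \<kappa> rests on \<open>inj_kseqs\<close>
  for the nodes of the tree; in the other direction the block of the empty sequence is already large
  enough.\<close>

lemma ex_bij_domain: "\<exists>d. bij_betw d (UNIV :: 'k set) (points \<times> (UNIV :: ('q + rat) set))"
proof -
  obtain e :: "('k \<rightharpoonup> 'k) \<Rightarrow> 'k" where e: "inj_on e kseqs"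
    using inj_kseqs by blast
  obtain m :: "'k \<Rightarrow> 'k \<times> 'k" where m: "bij m"
    using surj_pair by blast
  obtain m' :: "'k \<Rightarrow> 'k + 'k" where m': "surj m'"
    using surj_sum by blast
  obtain n :: "nat \<Rightarrow> 'k" where n: "inj n"
    using infinite_UNIV_kappa infinite_countable_subset by blast
  define P where "P = inv m"
  have P: "inj P" using m by (simp add: P_def bij_is_surj surj_imp_inj_inv)
  define S where "S = inv m'"
  have S: "inj S" using m' by (simp add: S_def surj_imp_inj_inv)
  define seq_code where "seq_code s = e (\<lambda>x. map_option num (app s x))" for s :: "('k, 'q option) lexfun"
  have seq: "inj_on seq_code seqs"
  proof (rule inj_onI)
    fix s t assume st: "s \<in> seqs" "t \<in> seqs" "seq_code s = seq_code t"
    have "(\<lambda>x. map_option num (app s x)) \<in> kseqs" if "s \<in> seqs" for s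
      using that by (auto simp: seqs_def kseqs_def dom_def)
    then have "(\<lambda>x. map_option num (app s x)) = (\<lambda>x. map_option num (app t x))"
      using inj_onD[OF e] st by (simp add: seq_code_def)
    then have "app s x = app t x" for x
      using option.inj_map[OF inj_num] by (metis injD)
    then show "s = t" by (rule lexfun_eqI)
  qed
  define opt_code where "opt_code j = S (case j of None \<Rightarrow> Inr kzero | Some i \<Rightarrow> Inl i)" for j :: "'k option"
  have opt: "inj opt_code"
    using S by (auto simp: inj_def opt_code_def split: option.splits)
  define sum_code where "sum_code d = S (map_sum num (n \<circ> to_nat) d)" for d :: "'q + rat"
  have sum: "inj sum_code"
  proof (rule injI)
    fix x y assume "sum_code x = sum_code y"
    then have "map_sum num (n \<circ> to_nat) x = map_sum num (n \<circ> to_nat) y"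
      using S by (simp add: sum_code_def inj_eq)
    then show "x = y"
      using inj_num n by (cases x; cases y) (auto simp: inj_eq)
  qed
  define enc where "enc = (\<lambda>((s, j), d). P (P (seq_code s, opt_code j), sum_code d))"
  have enc: "inj_on enc (points \<times> UNIV)"
    using seq by (auto simp: inj_on_def enc_def points_def inj_eq[OF P] inj_eq[OF opt] inj_eq[OF sum])
  obtain q :: 'q where "col q = kzero" using ex_col by blast
  define emb where "emb i = ((initial (\<lambda>_. q) kzero, Some i), Inr 0 :: 'q + rat)" for i :: 'k
  have "inj emb" "range emb \<subseteq> points \<times> UNIV"
    using initial_seqs by (auto simp: inj_def emb_def points_def)
  then show ?thesis
    using Schroeder_Bernstein[of emb UNIV "points \<times> UNIV" enc] enc by blast
qed

definition domain :: "'k \<Rightarrow> ('k, 'q) point \<times> ('q + rat)" where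
  "domain = (SOME d. bij_betw d UNIV (points \<times> UNIV))"

lemma bij_domain: "bij_betw domain UNIV (points \<times> UNIV)"
  unfolding domain_def using ex_bij_domain by (rule someI_ex)

definition key_of :: "'k struct \<Rightarrow> ('k, 'q) point \<times> ('q + rat) \<Rightarrow> ('k, 'q) key" where
  "key_of A = (\<lambda>(p, d). case d of Inl u \<Rightarrow> (p, Some u, 0) | Inr t \<Rightarrow> (p, None, cell_bij (mark A p) t))"

definition element :: "'k struct \<Rightarrow> 'k \<Rightarrow> ('k, 'q) key" where
  "element A x = key_of A (domain x)"

lemma bij_key_of: "bij_betw (key_of A) (points \<times> UNIV) (keys A)"
proof -
  have inj: "cell_bij m t = cell_bij m t' \<longleftrightarrow> t = t'" for m t t'
    using bij_betw_cell_bij[of m] by (auto simp: bij_betw_def inj_eq)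
  have range: "range (cell_bij m) = cell m" for m
    using bij_betw_cell_bij[of m] by (simp add: bij_betw_def)
  have cb: "cell_bij m t \<in> cell m" for m t
    using range[of m] by blast
  have "inj_on (key_of A) (points \<times> UNIV)"
    by (auto simp: inj_on_def key_of_def inj split: sum.splits)
  moreover have "key_of A x \<in> keys A" if "x \<in> points \<times> UNIV" for x
    using that cb by (auto simp: key_of_def keys_def split: sum.splits)
  moreover have "\<exists>x\<in>points \<times> UNIV. y = key_of A x" if "y \<in> keys A" for y
  proof -
    obtain p e r where y: "y = (p, e, r)" by (cases y)
    then have p: "p \<in> points" using that by (simp add: keys_def)
    show ?thesis
    proof (cases e)
      case None
      then have "r \<in> range (cell_bij (mark A p))" using that y range by (simp add: keys_def)
      then obtain t where "r = cell_bij (mark A p) t" by blast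
      then show ?thesis using p None y by (intro bexI[of _ "(p, Inr t)"]) (auto simp: key_of_def)
    next
      case (Some u)
      then show ?thesis using p y that by (intro bexI[of _ "(p, Inl u)"]) (auto simp: key_of_def keys_def)
    qed
  qed
  ultimately show ?thesis unfolding bij_betw_def by blast
qed

lemma bij_element: "bij_betw (element A) UNIV (keys A)"
  using bij_betw_trans[OF bij_domain bij_key_of] by (simp add: element_def[abs_def] comp_def)

definition order_of :: "'k struct \<Rightarrow> 'k struct" where
  "order_of A = {(0, [x, y]) | x y. element A x < element A y}"

lemma order_of_iff [simp]: "(0, [x, y]) \<in> order_of A \<longleftrightarrow> element A x < element A y"
  by (simp add: order_of_def)

lemma order_of_structures: "order_of A \<in> structures order_vocabulary"
  by (auto simp: structures_def atoms_order_vocabulary order_of_def)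

lemma element_eq_iff: "element A x = element A y \<longleftrightarrow> x = y"
  using bij_element[of A] by (simp add: bij_betw_def inj_eq)

lemma ex_element: "z \<in> keys A \<Longrightarrow> \<exists>x. z = element A x"
  using bij_element[of A] by (auto simp: bij_betw_def)

lemma element_in: "element A x \<in> keys A"
  using bij_element[of A] by (auto simp: bij_betw_def)

lemma order_of_models_DLO: "models (order_of A) DLO"
proof -
  have "\<exists>z. element A x < element A z \<and> element A z < element A y" if "element A x < element A y" for x y
    using keys_dense[OF element_in element_in that] ex_element by metis
  moreover have "\<exists>y. element A x < element A y" "\<exists>y. element A y < element A x" for x
    using keys_above[OF element_in] keys_below[OF element_in] ex_element by metis+
  moreover have "element A x < element A y \<or> x = y \<or> element A y < element A x" for x y
    using element_eq_iff linorder_neqE by metis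
  ultimately show ?thesis
    unfolding models_DLO order_of_iff using less_trans by blast
qed

lemma isomorphic_order_of:
  "isomorphic order_vocabulary (order_of A) (order_of B) \<longleftrightarrow> (\<exists>F. order_iso_on F (keys A) (keys B))"
proof
  assume "isomorphic order_vocabulary (order_of A) (order_of B)"
  then obtain h where h: "bij h" "\<And>x y. element A x < element A y \<longleftrightarrow> element B (h x) < element B (h y)"
    unfolding isomorphic_order_vocabulary by auto
  define F where "F = element B \<circ> h \<circ> inv (element A)"
  have inv: "inv (element A) (element A x) = x" for x
    using bij_element[of A] by (simp add: bij_betw_def)
  then have F: "F (element A x) = element B (h x)" for x by (simp add: F_def)
  have "order_iso_on F (keys A) (keys B)"
  proof (rule order_iso_onI)
    fix x y assume "x \<in> keys A" "y \<in> keys A" "x < y"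
    then show "F x < F y" using ex_element[of x A] ex_element[of y A] h(2) F by metis
  next
    have "keys A = range (element A)" "keys B = range (element B)" "surj h"
      using bij_element h(1) by (auto simp: bij_betw_def bij_def)
    then show "F ` keys A = keys B"
      by (simp add: image_image F) (metis image_image)
  qed
  then show "\<exists>F. order_iso_on F (keys A) (keys B)" by blast
next
  assume "\<exists>F. order_iso_on F (keys A) (keys B)"
  then obtain F where F: "order_iso_on F (keys A) (keys B)" by blast
  define h where "h = inv (element B) \<circ> (F \<circ> element A)"
  have "bij_betw (F \<circ> element A) UNIV (keys B)"
    using bij_betw_trans[OF bij_element] F by (auto simp: order_iso_on_def)
  then have "bij h"
    unfolding h_def using bij_betw_inv_into[OF bij_element[of B]] by (rule bij_betw_trans)
  moreover have h: "element B (h x) = F (element A x)" for x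
    using bij_betw_inv_into_right[OF bij_element[of B], of "F (element A x)"] order_iso_on_in[OF F element_in]
    by (simp add: h_def)
  have "element A x < element A y \<longleftrightarrow> element B (h x) < element B (h y)" for x y
    unfolding h using order_iso_on_less_iff[OF F element_in element_in] by simp
  ultimately show "isomorphic order_vocabulary (order_of A) (order_of B)"
    unfolding isomorphic_order_vocabulary order_of_iff by blast
qed

lemma isomorphic_order_of_iff:
  assumes "A \<in> structures V" "B \<in> structures V"
  shows "isomorphic order_vocabulary (order_of A) (order_of B) \<longleftrightarrow> isomorphic V A B"
  unfolding isomorphic_order_of
  using order_iso_if_isomorphic[OF assms] isomorphic_if_order_iso by blast

section \<open>Continuity of the reduction\<close>

text \<open>The colours along a node are fixed in advance, so a bit is the truth value of one atomic
  formula at a fixed tuple, which is found at one place of the code. Equality formulas and start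
  points consult no place at all.\<close>

lemma mark_coordinate:
  "\<exists>y. \<forall>\<eta> \<xi> :: 'k \<Rightarrow> 'k. \<eta> y = \<xi> y \<longrightarrow> mark (struct_of V \<rho> \<eta>) p = mark (struct_of V \<rho> \<xi>) p"
proof (cases "snd p")
  case None
  then show ?thesis by (simp add: mark_def)
next
  case (Some j)
  show ?thesis
  proof (cases "fst (idx j)")
    case 0
    then show ?thesis using Some by (simp add: mark_def atomic_type_def)
  next
    case (Suc n)
    then show ?thesis using Some
      by (intro exI[of _ "\<rho> (n, map (colour_at (fst p)) (snd (idx j)))"])
        (simp add: mark_def atomic_type_def struct_of_def)
  qed
qed

definition code_of :: "(nat \<times> 'k list \<Rightarrow> 'k) \<Rightarrow> 'k struct \<Rightarrow> 'k \<Rightarrow> 'k" where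
  "code_of \<pi> A z = (if z \<in> \<pi> ` A then kone else kzero)"

lemma struct_of_code_of:
  assumes "coding V \<pi>" "A \<in> structures V"
  shows "struct_of V \<pi> (code_of \<pi> A) = A"
proof -
  have "\<pi> x \<in> \<pi> ` A \<longleftrightarrow> x \<in> A" if "x \<in> atoms V" for x
    using assms that by (auto simp: coding_def bij_betw_def structures_def dest: inj_onD)
  then show ?thesis
    using assms(2) kzero_less_kone by (force simp: struct_of_def code_of_def structures_def)
qed

lemma code_of_cantor: "code_of \<pi> A \<in> cantor"
  by (auto simp: cantor_def code_of_def)

text \<open>A bit of the new code compares two fixed indices. If they belong to different points,
  the order of the points decides; otherwise only the mark of their common point enters.\<close>

lemma code_of_order_coordinate:
  assumes "coding order_vocabulary \<pi>"
  shows "\<exists>y. \<forall>\<eta> \<xi> :: 'k \<Rightarrow> 'k. \<eta> y = \<xi> y \<longrightarrow>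
    code_of \<pi> (order_of (struct_of V \<rho> \<eta>)) z = code_of \<pi> (order_of (struct_of V \<rho> \<xi>)) z"
proof -
  have \<pi>: "inj_on \<pi> (atoms order_vocabulary)" "z \<in> \<pi> ` atoms order_vocabulary"
    using assms by (auto simp: coding_def bij_betw_def)
  obtain a b where z: "z = \<pi> (0, [a, b])"
    using \<pi>(2) by (auto simp: atoms_order_vocabulary)
  have mem: "z \<in> \<pi> ` order_of A \<longleftrightarrow> element A a < element A b" for A
  proof
    assume "z \<in> \<pi> ` order_of A"
    then obtain c d where "\<pi> (0, [a, b]) = \<pi> (0, [c, d])" "element A c < element A d"
      using z by (auto simp: order_of_def)
    then show "element A a < element A b"
      using inj_onD[OF \<pi>(1), of "(0, [a, b])" "(0, [c, d])"] by (simp add: atoms_order_vocabulary)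
  qed (use z in force)
  obtain p d q e where dom: "domain a = (p, d)" "domain b = (q, e)" by fastforce
  obtain y where y: "\<And>\<eta> \<xi> :: 'k \<Rightarrow> 'k. \<eta> y = \<xi> y \<Longrightarrow> mark (struct_of V \<rho> \<eta>) p = mark (struct_of V \<rho> \<xi>) p"
    using mark_coordinate by blast
  have eq: "element A a < element A b \<longleftrightarrow> element B a < element B b" if "mark A p = mark B p" for A B
  proof (cases "p = q")
    case True
    then have "key_of A (p, d) = key_of B (p, d)" "key_of A (q, e) = key_of B (q, e)"
      using that by (simp_all add: key_of_def split: sum.split)
    then show ?thesis by (simp add: element_def dom)
  next
    case False
    have "fst (element C a) = p" "fst (element C b) = q" for C
      by (simp_all add: element_def dom key_of_def split: sum.split)
    then show ?thesis using False by (simp add: less_prod_def')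
  qed
  show ?thesis
  proof (intro exI[of _ y] allI impI)
    fix \<eta> \<xi> :: "'k \<Rightarrow> 'k" assume "\<eta> y = \<xi> y"
    then have "element (struct_of V \<rho> \<eta>) a < element (struct_of V \<rho> \<eta>) b \<longleftrightarrow>
        element (struct_of V \<rho> \<xi>) a < element (struct_of V \<rho> \<xi>) b"
      by (rule eq[OF y])
    then show "code_of \<pi> (order_of (struct_of V \<rho> \<eta>)) z = code_of \<pi> (order_of (struct_of V \<rho> \<xi>)) z"
      unfolding code_of_def mem by (rule arg_cong)
  qed
qed

lemma S_complete_DLO:
  assumes \<pi>: "coding order_vocabulary (\<pi> :: nat \<times> 'k list \<Rightarrow> 'k)"
  shows "S_complete (ISO_theory order_vocabulary \<pi> DLO)"
  unfolding S_complete_def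
proof (intro conjI ballI)
  show "ISO_theory order_vocabulary \<pi> DLO \<in> S_class"
    using \<pi> by (rule ISO_DLO_in_S_class)
next
  fix F :: "('k \<Rightarrow> 'k) rel" assume "F \<in> S_class"
  then obtain V \<rho> M where F: "F = ISO V \<rho> M"
    by (auto simp: S_class_def)
  define f where "f \<eta> = code_of \<pi> (order_of (struct_of V \<rho> \<eta>))" for \<eta> :: "'k \<Rightarrow> 'k"
  have struct: "struct_of V \<rho> \<eta> \<in> structures V" for \<eta> :: "'k \<Rightarrow> 'k"
    by (auto simp: struct_of_def structures_def)
  have f: "struct_of order_vocabulary \<pi> (f \<eta>) = order_of (struct_of V \<rho> \<eta>)" for \<eta>
    unfolding f_def by (rule struct_of_code_of[OF \<pi> order_of_structures])
  have codes: "f \<eta> \<in> codes order_vocabulary \<pi> {A \<in> structures order_vocabulary. models A DLO}" for \<eta>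
    unfolding codes_def using f[of \<eta>] code_of_cantor order_of_structures order_of_models_DLO
    by (simp add: f_def)
  have "borel_map_on (Field F) f"
    by (rule borel_map_on_if_coordinatewise) (unfold f_def, rule code_of_order_coordinate[OF \<pi>])
  moreover have "f ` Field F \<subseteq> Field (ISO_theory order_vocabulary \<pi> DLO)"
    using codes by (auto simp: ISO_theory_def Field_ISO)
  moreover have "(\<eta>, \<xi>) \<in> F \<longleftrightarrow> (f \<eta>, f \<xi>) \<in> ISO_theory order_vocabulary \<pi> DLO"
    if "\<eta> \<in> Field F" "\<xi> \<in> Field F" for \<eta> \<xi>
    using that codes isomorphic_order_of_iff[OF struct struct]
    by (simp add: F Field_ISO ISO_theory_def) (simp add: ISO_def f)
  ultimately show "borel_reducible F (ISO_theory order_vocabulary \<pi> DLO)"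
    unfolding borel_reducible_def by blast
qed

end

theorem mainTheorem8:
  fixes \<pi> :: "nat \<times> 'k::wellorder list \<Rightarrow> 'k"
  assumes "Card_order (kappa :: 'k rel)"
    and "natLeq <o (kappa :: 'k rel)"
    and "|kseqs :: ('k \<rightharpoonup> 'k) set| =o (kappa :: 'k rel)"
    and "coding order_vocabulary \<pi>"
  shows "S_complete (ISO_theory order_vocabulary \<pi> DLO)"
proof -
  interpret kappa_exp "TYPE('k)"
    using assms(1-3) by unfold_locales
  obtain col :: "'k sat_order \<Rightarrow> 'k" and num where sat: "saturated_order col num"
    using ex_saturated_order by blast
  obtain idx :: "'k \<Rightarrow> nat \<times> 'k list" where "surj idx"
    using surj_nat_lists by blast
  then interpret structure_order "TYPE('k)" col num idx
    using sat by (simp add: structure_order_def structure_order_axioms_def)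
  show ?thesis
    using assms(4) by (rule S_complete_DLO)
qed

end
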